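(* Let $(p_k)_{k\in\mathbb{N}}$ be the enumeration of the prime numbers in increasing order, and let $(X_k)_{k\in\mathbb{N}}$ be independent random variables with $X_k\sim\mathrm{Geom}(1-1/p_k)$, i.e. $\mathbf{P}\{X_k=m\}=p_k^{-m}(1-1/p_k)$ for $m\ge0$. Let $\nu_n=\sum_{k=1}^\infty X_k\delta_{\log p_k/\log p_n}$, $n\in\mathbb{N}$. Then $\nu_n$ converges vaguely in distribution to $\eta$ as $n\to\infty$ as point processes on $(0,\infty)$, and $$\frac{1}{\log p_n}\sum_{k=1}^n X_k\log p_k\longrightarrow D\quad\text{in distribution as } n\to\infty.$$
   Context: $\delta_x$ is the Dirac measure at $x$. $\eta$ denotes the Poisson process on $(0,\infty)$ with intensity measure $t^{-1}\,dt$. $D$ is the standard Dickman random variable: its law is that of $\int_0^1 t\,\eta(dt)$, the sum of the points of $\eta$ in $(0,1)$ (equivalently, the unique non-negative solution in law of $W=_d Q(W+1)$ with $Q$ uniform on $[0,1]$ independent of $W$). Point processes $\xi_n$ on $(0,\infty)$ converge vaguely in distribution to $\xi$ if they converge in distribution as random elements of the space of locally finite measures on $(0,\infty)$ with the vague topology; equivalently, $\int f\,d\xi_n\to\int f\,d\xi$ in distribution for every bounded non-negative continuous $f$ on $(0,\infty)$ with relatively compact support. *)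

theory Defs
  imports "HOL-Probability.Probability" "HOL-Computational_Algebra.Primes"
    "HOL-Library.Infinite_Set"
begin

section \<open>Locally finite measures on the open half-line and the vague topology\<close>

text \<open>Measures on the open half-line are represented as \<^typ>\<open>real measure\<close>s with underlying
  set \<open>{0<..}\<close> and its Borel \<open>\<sigma>\<close>-algebra. Compactness below is compactness of subsets of
  \<open>{0<..}\<close>, so mass may accumulate at \<open>0\<close>.\<close>

definition pos_borel :: "real measure" where
  "pos_borel = restrict_space borel {0<..}"

definition locally_finite_measures :: "real measure set" where
  "locally_finite_measures =
     {\<mu>. space \<mu> = {0<..} \<and> sets \<mu> = sets pos_borel \<and>
         (\<forall>K. compact K \<and> K \<subseteq> {0<..} \<longrightarrow> emeasure \<mu> K < \<infinity>)}"

text \<open>Non-negative continuous functions with relatively compact support in \<open>{0<..}\<close>; these are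
  automatically bounded on \<open>{0<..}\<close>. Values outside \<open>{0<..}\<close> are irrelevant.\<close>

definition vague_test_function :: "(real \<Rightarrow> real) \<Rightarrow> bool" where
  "vague_test_function f \<longleftrightarrow>
     continuous_on {0<..} f \<and> (\<forall>x\<in>{0<..}. 0 \<le> f x) \<and>
     (\<exists>K. compact K \<and> K \<subseteq> {0<..} \<and> (\<forall>x\<in>{0<..} - K. f x = 0))"

text \<open>The coarsest topology making \<open>\<mu> \<mapsto> \<integral> f d\<mu>\<close> continuous for every test function \<open>f\<close>.\<close>

definition vague_topology :: "real measure topology" where
  "vague_topology = topology_generated_by
     {{\<mu> \<in> locally_finite_measures. (LINT x|\<mu>. f x) \<in> U} | f U. vague_test_function f \<and> open U}"

lemma topspace_vague_topology: "topspace vague_topology = locally_finite_measures"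
proof -
  have "locally_finite_measures \<in>
      {{\<mu> \<in> locally_finite_measures. (LINT x|\<mu>. f x) \<in> U} | f U. vague_test_function f \<and> open U}"
    by (intro CollectI exI[of _ "\<lambda>_. 0"] exI[of _ UNIV])
       (auto simp: vague_test_function_def intro!: exI[of _ "{}"])
  thus ?thesis
    unfolding vague_topology_def topology_generated_by_topspace by auto
qed


section \<open>Random elements and convergence in distribution\<close>

definition topology_borel :: "'s topology \<Rightarrow> 's measure" where
  "topology_borel T = sigma (topspace T) {U. openin T U}"

text \<open>The random elements may live on different probability spaces.\<close>

definition converges_in_distribution ::
  "'s topology \<Rightarrow> (nat \<Rightarrow> 'a measure) \<Rightarrow> (nat \<Rightarrow> 'a \<Rightarrow> 's) \<Rightarrow> 'b measure \<Rightarrow> ('b \<Rightarrow> 's) \<Rightarrow> bool" where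
  "converges_in_distribution T M \<xi> N \<zeta> \<longleftrightarrow>
     (\<forall>n. \<xi> n \<in> M n \<rightarrow>\<^sub>M topology_borel T) \<and> \<zeta> \<in> N \<rightarrow>\<^sub>M topology_borel T \<and>
     (\<forall>F :: 's \<Rightarrow> real. continuous_map T euclideanreal F \<and> bounded (F ` topspace T) \<longrightarrow>
        (\<lambda>n. LINT \<omega>|M n. F (\<xi> n \<omega>)) \<longlonglongrightarrow> (LINT \<omega>|N. F (\<zeta> \<omega>)))"


section \<open>Point processes and the Poisson process\<close>

definition counting_valued :: "real measure \<Rightarrow> bool" where
  "counting_valued \<mu> \<longleftrightarrow> (\<forall>B\<in>sets \<mu>. emeasure \<mu> B = \<infinity> \<or> (\<exists>k::nat. emeasure \<mu> B = of_nat k))"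

definition point_process :: "'a measure \<Rightarrow> ('a \<Rightarrow> real measure) \<Rightarrow> bool" where
  "point_process M \<xi> \<longleftrightarrow>
     prob_space M \<and> \<xi> \<in> M \<rightarrow>\<^sub>M topology_borel vague_topology \<and>
     (\<forall>\<omega>\<in>space M. counting_valued (\<xi> \<omega>))"

definition vague_convergence_in_distribution ::
  "(nat \<Rightarrow> 'a measure) \<Rightarrow> (nat \<Rightarrow> 'a \<Rightarrow> real measure) \<Rightarrow> 'b measure \<Rightarrow> ('b \<Rightarrow> real measure) \<Rightarrow> bool" where
  "vague_convergence_in_distribution M \<xi> N \<zeta> \<longleftrightarrow>
     (\<forall>n. point_process (M n) (\<xi> n)) \<and> point_process N \<zeta> \<and>
     converges_in_distribution vague_topology M \<xi> N \<zeta>"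

text \<open>The Poisson law is written out because \<^const>\<open>poisson_pmf\<close> requires a strictly positive
  rate, whereas sets of intensity \<open>0\<close> occur here.\<close>

definition poisson_process :: "real measure \<Rightarrow> 'a measure \<Rightarrow> ('a \<Rightarrow> real measure) \<Rightarrow> bool" where
  "poisson_process \<Lambda> M \<xi> \<longleftrightarrow>
     point_process M \<xi> \<and>
     (\<forall>B\<in>sets pos_borel. emeasure \<Lambda> B < \<infinity> \<longrightarrow>
        (\<forall>k::nat. measure M {\<omega> \<in> space M. emeasure (\<xi> \<omega>) B = of_nat k} =
           measure \<Lambda> B ^ k / fact k * exp (- measure \<Lambda> B))) \<and>
     (\<forall>(I :: nat set) (B :: nat \<Rightarrow> real set).
        finite I \<and> (\<forall>i\<in>I. B i \<in> sets pos_borel) \<and> disjoint_family_on B I \<longrightarrow>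
        prob_space.indep_vars M (\<lambda>_. borel) (\<lambda>i \<omega>. emeasure (\<xi> \<omega>) (B i)) I)"

definition inverse_intensity :: "real measure" where
  "inverse_intensity = density (restrict_space lborel {0<..}) (\<lambda>t. ennreal (1 / t))"

text \<open>The standard Dickman law, where \<open>\<eta>\<close> is a Poisson process on the probability space \<open>N\<close> with
  intensity \<^const>\<open>inverse_intensity\<close>.\<close>

definition dickman_law :: "'b measure \<Rightarrow> ('b \<Rightarrow> real measure) \<Rightarrow> real measure" where
  "dickman_law N \<eta> = distr N borel (\<lambda>\<omega>. LINT t:{0<..<1}|\<eta> \<omega>. t)"


section \<open>The point processes attached to the primes\<close>

text \<open>Primes are enumerated from index \<open>0\<close>: \<open>nth_prime 0 = 2\<close>.\<close>

definition nth_prime :: "nat \<Rightarrow> nat" where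
  "nth_prime k = enumerate {p. prime p} k"

text \<open>The measure \<open>\<Sum>\<^sub>k w k \<cdot> \<delta>\<^bsub>x k\<^esub>\<close> on \<open>{0<..}\<close>, obtained as an image of
  the measure on indices with weights \<open>w\<close>; see the evaluation lemma below.\<close>

definition dirac_series :: "(nat \<Rightarrow> nat) \<Rightarrow> (nat \<Rightarrow> real) \<Rightarrow> real measure" where
  "dirac_series w x = distr (density (count_space UNIV) (\<lambda>k. of_nat (w k))) pos_borel x"

lemma emeasure_dirac_series:
  assumes "\<And>k. 0 < x k" "B \<in> sets pos_borel"
  shows "emeasure (dirac_series w x) B = (\<Sum>k. of_nat (w k) * indicator B (x k))"
proof -
  have "x \<in> density (count_space UNIV) (\<lambda>k. of_nat (w k)) \<rightarrow>\<^sub>M pos_borel"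
    using assms(1) by (auto simp: measurable_def pos_borel_def space_restrict_space)
  hence "emeasure (dirac_series w x) B =
      (\<integral>\<^sup>+k. of_nat (w k) * indicator (x -` B) k \<partial>count_space UNIV)"
    unfolding dirac_series_def using assms(2) by (simp add: emeasure_distr emeasure_density)
  also have "\<dots> = (\<Sum>k. of_nat (w k) * indicator B (x k))"
    by (simp add: nn_integral_count_space_nat indicator_def)
  finally show ?thesis .
qed

definition prime_process :: "(nat \<Rightarrow> 'a \<Rightarrow> nat) \<Rightarrow> nat \<Rightarrow> 'a \<Rightarrow> real measure" where
  "prime_process X n \<omega> =
     dirac_series (\<lambda>k. X k \<omega>) (\<lambda>k. ln (real (nth_prime k)) / ln (real (nth_prime n)))"

end

theory Submission
  imports Defs
begin

text \<open>
  Write \<open>p\<^sub>k\<close> for the primes and \<open>q\<^sub>k = 1 / p\<^sub>k\<close>. The idea is to read the prime process off the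
  Poisson process \<open>\<eta>\<close> itself, cell by cell. Let \<open>V\<^sub>k\<close> be the Euler product
  \<open>\<Prod>\<^sub>i\<^sub><\<^sub>k 1 / (1 - q\<^sub>i)\<close> and cut \<open>(1 / V\<^sub>n\<^sub>+\<^sub>1, \<infinity>)\<close> into the cells
  \<open>(V\<^sub>k / V\<^sub>n\<^sub>+\<^sub>1, V\<^sub>k\<^sub>+\<^sub>1 / V\<^sub>n\<^sub>+\<^sub>1]\<close>. With intensity \<open>dt / t\<close> the number of points of \<open>\<eta>\<close> in the
  \<open>k\<close>-th cell is Poisson with mean \<open>- ln (1 - q\<^sub>k)\<close>, whatever \<open>n\<close> is. So these numbers are independent
  and vanish with probability \<open>1 - q\<^sub>k\<close>, exactly as the geometric variables \<open>X\<^sub>k\<close> do; and both exceed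
  \<open>1\<close> with probability at most \<open>q\<^sub>k\<^sup>2\<close>, which is summable.

  On the geometric side, Mertens' theorems say that \<open>ln p\<^sub>k / V\<^sub>k\<^sub>+\<^sub>1\<close> has a positive limit. Hence the
  atom \<open>ln p\<^sub>k / ln p\<^sub>n\<close> of the prime process lies close to the \<open>k\<close>-th cell, and moving every point of
  \<open>\<eta>\<close> to the atom of its cell converges to the identity. For almost every fixed realisation of \<open>\<eta>\<close>,
  dominated convergence (\<open>weighted_sum_prime_points_tendsto\<close>) then gives convergence of the integrals of
  all functions that are almost everywhere continuous, bounded by a multiple of \<open>t\<close>, and zero for
  large \<open>t\<close>. This covers the test functions of the vague topology as well as \<open>t \<mapsto> t\<close> on \<open>(0, 1]\<close>, whose integral is the Dickman variable.

  The two families of weights agree in law only up to the summable errors \<open>q\<^sub>k\<^sup>2\<close>, so the first \<open>K\<close>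
  weights cannot be exchanged cheaply. However, their atoms tend to \<open>0\<close> as \<open>n \<rightarrow> \<infinity>\<close>, and the pathwise
  limit holds whatever these weights are. Keeping \<open>X\<^sub>k\<close> for \<open>k < K\<close> and using the cell counts
  for \<open>k \<ge> K\<close> costs at most the tail of \<open>\<Sum> q\<^sub>k\<^sup>2\<close> (\<open>coupling_limit\<close>). Both claims are this one
  statement applied to different functionals of the weights: for the first claim the pathwise limit is a
  limit in the vague topology, which every continuous functional on the space of measures respects.
\<close>

section \<open>The theorems of Mertens\<close>

text \<open>The coefficient occurs twice in the row of sum \<open>2 * 4 ^ m\<close>.\<close>

lemma central_binomial_odd_le: "(2 * m + 1 choose m) \<le> 4 ^ m"
proof -
  have "(2 * m + 1 choose m) + (2 * m + 1 choose (m + 1)) = (\<Sum>k\<in>{m, m+1}. (2 * m + 1 choose k))"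
    by simp
  also have "\<dots> \<le> (\<Sum>k\<le>2 * m + 1. (2 * m + 1 choose k))"
    by (rule sum_mono2) auto
  also have "\<dots> = 2 ^ (2 * m + 1)" by (rule choose_row_sum)
  also have "\<dots> = 2 * 4 ^ m" by (simp add: power_mult)
  also have "(2 * m + 1 choose (m + 1)) = (2 * m + 1 choose m)"
    by (subst binomial_symmetric) (auto)
  finally show ?thesis by simp
qed

lemma prod_primes_dvd:
  fixes A :: "nat set"
  assumes "finite A" "\<And>p. p \<in> A \<Longrightarrow> prime p" "\<And>p. p \<in> A \<Longrightarrow> p dvd n"
  shows "\<Prod>A dvd n"
  using assms
proof (induction A rule: finite_induct)
  case (insert p A)
  have "coprime p (\<Prod>A)"
    using insert by (intro prod_coprime_right primes_coprime) auto
  then show ?case using insert by (simp add: divides_mult)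
qed simp

text \<open>Erdos' induction: the primes in \<open>(m + 1, 2 m + 1]\<close> all divide \<open>2 m + 1\<close> choose \<open>m\<close>, and an even
  \<open>n > 2\<close> is not prime.\<close>

lemma primorial_le: "\<Prod>{p. prime p \<and> p \<le> n} \<le> (4::nat) ^ n"
proof (induction n rule: less_induct)
  case (less n)
  consider "n \<le> 1" | "n = 2" | "n > 2" "even n" | m where "n = 2 * m + 1" "m \<ge> 1"
  proof -
    have "odd n \<Longrightarrow> n > 1 \<Longrightarrow> \<exists>m. n = 2 * m + 1 \<and> m \<ge> 1"
      by (auto elim!: oddE)
    then show ?thesis using that by fastforce
  qed
  then show ?case
  proof cases
    case 1
    have empty: "{p::nat. prime p \<and> p \<le> n} = {}"
      using 1 by (auto dest!: prime_gt_1_nat)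
    show ?thesis unfolding empty by simp
  next
    case 2
    have "p = 2" if "prime p" "p \<le> 2" for p :: nat
      using prime_gt_1_nat[OF that(1)] that(2) by simp
    then have "{p::nat. prime p \<and> p \<le> n} = {2}" using 2 by auto
    then show ?thesis using 2 by simp
  next
    case 3
    have "\<not> prime n" using 3 prime_odd_nat by blast
    then have "p \<le> n \<longleftrightarrow> p \<le> n - 1" if "prime p" for p
      using that 3 by (cases "p = n") auto
    then have eq: "{p. prime p \<and> p \<le> n} = {p. prime p \<and> p \<le> n - 1}"
      by blast
    have "\<Prod>{p. prime p \<and> p \<le> n} \<le> 4 ^ (n - 1)"
      unfolding eq using 3 by (intro less) auto
    also have "\<dots> \<le> 4 ^ n" by (rule power_increasing) auto
    finally show ?thesis .
  next
    case (4 m)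
    let ?A = "{p. prime p \<and> p \<le> m + 1}" and ?B = "{p. prime p \<and> m + 1 < p \<and> p \<le> n}"
    have "\<Prod>?B dvd (2 * m + 1 choose m)"
    proof (rule prod_primes_dvd)
      show "prime p" if "p \<in> ?B" for p using that by auto
      fix p assume p: "p \<in> ?B"
      have "fact m * fact (2 * m + 1 - m) * (2 * m + 1 choose m) = fact (2 * m + 1)"
        by (rule binomial_fact_lemma) simp
      moreover have "p dvd (fact (2 * m + 1) :: nat)"
        using p 4 prime_gt_0_nat by (intro dvd_fact) auto
      ultimately have "p dvd fact m * fact (m + 1) * (2 * m + 1 choose m)"
        by (metis add_diff_cancel_left' mult_2 add.assoc)
      moreover have "\<not> p dvd fact m" "\<not> p dvd fact (m + 1)"
        using p prime_dvd_fact_iff[of p m] prime_dvd_fact_iff[of p "m + 1"] by (auto simp del: fact_Suc)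
      ultimately show "p dvd (2 * m + 1 choose m)"
        using p by (auto simp: prime_dvd_mult_iff)
    qed auto
    then have B: "\<Prod>?B \<le> 4 ^ m"
    proof -
      assume "\<Prod>?B dvd (2 * m + 1 choose m)"
      then have "\<Prod>?B \<le> (2 * m + 1 choose m)"
        by (rule dvd_imp_le) (rule zero_less_binomial, simp)
      also note central_binomial_odd_le[of m]
      finally show ?thesis .
    qed
    have A: "\<Prod>?A \<le> 4 ^ (m + 1)" using 4 by (intro less) auto
    have "{p. prime p \<and> p \<le> n} = ?A \<union> ?B" using 4 by auto
    then have "\<Prod>{p. prime p \<and> p \<le> n} = \<Prod>?A * \<Prod>?B"
      by (simp only:) (rule prod.union_disjoint, auto)
    also have "\<dots> \<le> 4 ^ (m + 1) * 4 ^ m" by (intro mult_mono A B) auto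
    also have "\<dots> = 4 ^ n" using 4 by (simp add: power_add mult_2)
    finally show ?thesis .
  qed
qed

lemma theta_le: "(\<Sum>p | prime p \<and> p \<le> n. ln (real p)) \<le> real n * ln 4"
proof -
  have "(\<Sum>p | prime p \<and> p \<le> n. ln (real p)) = ln (\<Prod>p | prime p \<and> p \<le> n. real p)"
    by (subst ln_prod) (auto dest: prime_gt_0_nat)
  also have "(\<Prod>p | prime p \<and> p \<le> n. real p) = real (\<Prod>{p. prime p \<and> p \<le> n})"
    by simp
  also have "ln \<dots> \<le> ln (real (4 ^ n))"
  proof -
    have "(0::nat) < \<Prod>{p. prime p \<and> p \<le> n}"
      by (intro prod_pos) (auto dest: prime_gt_0_nat)
    then show ?thesis using primorial_le[of n] by (subst ln_le_cancel_iff) (auto simp del: of_nat_prod of_nat_power)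
  qed
  also have "\<dots> = real n * ln 4" by (simp add: ln_realpow)
  finally show ?thesis .
qed

lemma card_multiples: "card {m\<in>{1..n}. d dvd m} = n div d" if "d > 0" for d n :: nat
proof -
  have "{m\<in>{1..n}. d dvd m} = (\<lambda>k. d * k) ` {1..n div d}"
  proof (intro equalityI subsetI)
    fix m assume "m \<in> {m\<in>{1..n}. d dvd m}"
    then obtain k where k: "m = d * k" "1 \<le> m" "m \<le> n" by auto
    then have "k \<le> n div d" using that by (simp add: less_eq_div_iff_mult_less_eq mult.commute)
    then show "m \<in> (\<lambda>k. d * k) ` {1..n div d}" using k by (auto simp: Suc_le_eq)
  next
    fix m assume "m \<in> (\<lambda>k. d * k) ` {1..n div d}"
    then obtain k where k: "m = d * k" "1 \<le> k" "k \<le> n div d"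
      by (metis (no_types, lifting) atLeastAtMost_iff imageE)
    then have "d * k \<le> n" using that by (simp add: less_eq_div_iff_mult_less_eq mult.commute)
    then show "m \<in> {m\<in>{1..n}. d dvd m}" using k that by (auto simp: Suc_le_eq)
  qed
  moreover have "inj_on (\<lambda>k. d * k) {1..n div d}" using that by (auto simp: inj_on_def)
  ultimately show ?thesis by (simp add: card_image)
qed

text \<open>Legendre's formula: \<open>multiplicity p m\<close> counts the powers of \<open>p\<close> that divide \<open>m\<close>, and the order of
  summation over \<open>m\<close> and over powers is exchanged.\<close>

lemma multiplicity_fact:
  fixes p :: nat
  assumes p: "prime p"
  shows "multiplicity p (fact n :: nat) = (\<Sum>j=1..n. n div p ^ j)"
proof -
  have "multiplicity p (fact n :: nat) = (\<Sum>m=1..n. multiplicity p m)"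
    using p by (simp add: fact_prod prime_elem_multiplicity_prod_distrib)
  also have "\<dots> = (\<Sum>m=1..n. \<Sum>j=1..n. of_bool (p ^ j dvd m))"
  proof (rule sum.cong[OF refl])
    fix m assume m: "m \<in> {1..n}"
    have "multiplicity p m < m"
    proof -
      have "p ^ multiplicity p m \<le> m" using m by (intro dvd_imp_le multiplicity_dvd) auto
      moreover have "multiplicity p m < p ^ multiplicity p m"
        using p prime_gt_1_nat by (intro power_gt_expt) auto
      ultimately show ?thesis by linarith
    qed
    then have "{j \<in> {1..n}. p ^ j dvd m} = {1..multiplicity p m}"
    proof -
      have "p ^ j dvd m \<longleftrightarrow> j \<le> multiplicity p m" for j
        using m p by (subst power_dvd_iff_le_multiplicity) (auto simp: not_prime_unit)
      then have "{j \<in> {1..n}. p ^ j dvd m} = {j \<in> {1..n}. j \<le> multiplicity p m}"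
        by (simp only:)
      also have "\<dots> = {1..multiplicity p m}"
        using \<open>multiplicity p m < m\<close> m by (intro set_eqI) (simp, linarith)
      finally show ?thesis .
    qed
    then have "multiplicity p m = card {j \<in> {1..n}. p ^ j dvd m}" by simp
    also have "\<dots> = (\<Sum>j=1..n. of_bool (p ^ j dvd m))" by (simp add: Int_def)
    finally show "multiplicity p m = (\<Sum>j=1..n. of_bool (p ^ j dvd m))" .
  qed
  also have "\<dots> = (\<Sum>j=1..n. \<Sum>m=1..n. of_bool (p ^ j dvd m))" by (rule sum.swap)
  also have "\<dots> = (\<Sum>j=1..n. n div p ^ j)"
  proof (rule sum.cong[OF refl])
    fix j assume "j \<in> {1..n}"
    have "(\<Sum>m=1..n. of_bool (p ^ j dvd m)) = card {m\<in>{1..n}. p ^ j dvd m}" by (simp add: Int_def)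
    then show "(\<Sum>m=1..n. of_bool (p ^ j dvd m)) = n div p ^ j"
      using card_multiples[of "p ^ j" n] p prime_gt_0_nat by simp
  qed
  finally show ?thesis .
qed

lemma multiplicity_fact_bounds:
  fixes p :: nat
  assumes p: "prime p" and n: "n \<ge> 1"
  shows "real n / real p - 1 \<le> real (multiplicity p (fact n :: nat))"
    and "real (multiplicity p (fact n :: nat)) \<le> real n / (real p - 1)"
proof -
  have p1: "real p > 1" using prime_gt_1_nat[OF p] by simp
  have "n div p ^ 1 \<le> (\<Sum>j=1..n. n div p ^ j)"
    using n by (intro member_le_sum) auto
  moreover have "real n / real p - 1 \<le> real (n div p)"
    using floor_divide_of_nat_eq[of n p, where 'a=real] by linarith
  ultimately show "real n / real p - 1 \<le> real (multiplicity p (fact n :: nat))"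
    by (subst multiplicity_fact[OF p]) (simp add: order.trans[OF _ of_nat_mono] del: of_nat_sum)
  have "real (multiplicity p (fact n :: nat)) = (\<Sum>j=1..n. real (n div p ^ j))"
    by (simp add: multiplicity_fact[OF p])
  also have "\<dots> \<le> (\<Sum>j=1..n. real n * (1 / real p) ^ j)"
    by (intro sum_mono) (metis of_nat_div_le_of_nat of_nat_power power_one_over times_divide_eq_right mult.right_neutral)
  also have "\<dots> = real n * (\<Sum>j=1..n. (1 / real p) ^ j)" by (simp add: sum_distrib_left)
  also have "(\<Sum>j=1..n. (1 / real p) ^ j) \<le> 1 / (real p - 1)"
  proof -
    have "(\<Sum>j=1..n. (1 / real p) ^ j) = (\<Sum>j<n. (1 / real p) ^ Suc j)"
      by (rule sum.reindex_bij_witness[of _ Suc "\<lambda>j. j - 1"]) auto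
    also have "\<dots> = (1 / real p) * (\<Sum>j<n. (1 / real p) ^ j)" by (simp add: sum_distrib_left)
    also have "\<dots> \<le> (1 / real p) * (1 / (1 - 1 / real p))"
    proof (intro mult_left_mono)
      have "(\<Sum>j<n. (1 / real p) ^ j) \<le> (\<Sum>j. (1 / real p) ^ j)"
        using p1 by (intro sum_le_suminf summable_geometric) auto
      also have "\<dots> = 1 / (1 - 1 / real p)" using p1 by (intro suminf_geometric) auto
      finally show "(\<Sum>j<n. (1 / real p) ^ j) \<le> 1 / (1 - 1 / real p)" .
    qed auto
    also have "\<dots> = 1 / (real p - 1)" using p1 by (simp add: field_simps)
    finally show ?thesis .
  qed
  finally show "real (multiplicity p (fact n :: nat)) \<le> real n / (real p - 1)"
    by (simp add: mult_left_mono)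
qed

lemma ln_fact_eq:
  "ln (fact n) = (\<Sum>p | prime p \<and> p \<le> n. real (multiplicity p (fact n :: nat)) * ln (real p))"
proof -
  have pf: "prime_factors (fact n :: nat) = {p. prime p \<and> p \<le> n}"
    by (auto simp: prime_factors_dvd prime_dvd_fact_iff)
  have "(fact n :: nat) = (\<Prod>p | prime p \<and> p \<le> n. p ^ multiplicity p (fact n :: nat))"
    using prime_factorization_nat[of "fact n"] by (simp add: pf)
  then have "(fact n :: real) = (\<Prod>p | prime p \<and> p \<le> n. real p ^ multiplicity p (fact n :: nat))"
    by (metis (no_types, lifting) of_nat_fact of_nat_power of_nat_prod prod.cong)
  also have "ln \<dots> = (\<Sum>p | prime p \<and> p \<le> n. ln (real p ^ multiplicity p (fact n :: nat)))"
    by (subst ln_prod) (auto dest: prime_gt_0_nat)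
  also have "\<dots> = (\<Sum>p | prime p \<and> p \<le> n. real (multiplicity p (fact n :: nat)) * ln (real p))"
    by (intro sum.cong refl) (auto simp: ln_realpow dest: prime_gt_0_nat)
  finally show ?thesis .
qed

text \<open>\<open>n ^ n / n!\<close> is one term of the exponential series at \<open>n\<close>.\<close>

lemma ln_fact_ge: "real n * ln (real n) - real n \<le> ln (fact n)" if "n \<ge> 1"
proof -
  have "real n ^ n / fact n \<le> exp (real n)"
  proof -
    have "(\<Sum>k\<in>{n}. real n ^ k /\<^sub>R fact k) \<le> (\<Sum>k. real n ^ k /\<^sub>R fact k)"
      by (intro sum_le_suminf summable_exp_generic) auto
    then show ?thesis by (simp add: exp_def field_simps)
  qed
  then have "ln (real n ^ n / fact n) \<le> real n"
    using that by (metis divide_pos_pos exp_gt_zero fact_gt_zero ln_exp ln_le_cancel_iff of_nat_0_less_iff zero_less_power One_nat_def Suc_le_eq)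
  then show ?thesis using that by (simp add: ln_div ln_realpow)
qed

lemma summable_ln_over_square: "summable (\<lambda>m. ln (real m) / (real m * (real m - 1)))"
proof (rule summable_comparison_test_ev)
  show "summable (\<lambda>m. 4 * real m powr (- 3 / 2))"
    by (intro summable_mult) (simp add: summable_real_powr_iff)
  show "\<forall>\<^sub>F m in sequentially. norm (ln (real m) / (real m * (real m - 1))) \<le> 4 * real m powr (- 3 / 2)"
    using eventually_ge_at_top[of 2]
  proof eventually_elim
    case (elim m)
    define r where "r = sqrt (real m)"
    have r: "r > 0" "real m = r\<^sup>2" using elim by (auto simp: r_def)
    \<comment> \<open>comparison with \<open>m powr (- 3 / 2)\<close>, as \<open>ln m\<close> is at most twice the square root of \<open>m\<close>\<close>
    have "ln (real m) = 2 * ln r" using r by (simp add: ln_realpow)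
    also have "\<dots> \<le> 2 * r" using r ln_le_minus_one[of r] by simp
    finally have "ln (real m) \<le> 2 * r" .
    have "norm (ln (real m) / (real m * (real m - 1))) = ln (real m) / (real m * (real m - 1))"
      using elim by simp
    also have "\<dots> \<le> (2 * r) / (real m * (real m / 2))"
      using elim \<open>ln (real m) \<le> 2 * r\<close> r(1) by (intro frac_le mult_left_mono) auto
    also have "\<dots> = 4 / (real m * r)" using r by (simp add: field_simps power2_eq_square)
    also have "\<dots> = 4 * real m powr (- 3 / 2)"
    proof -
      have "real m * r = real m powr 1 * real m powr (1 / 2)" using elim by (simp add: r_def powr_half_sqrt)
      also have "\<dots> = real m powr (3 / 2)" by (subst powr_add[symmetric]) simp
      finally have "4 / (real m * r) = 4 * inverse (real m powr (3 / 2))" by (simp only: divide_inverse)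
      also have "inverse (real m powr (3 / 2)) = real m powr (- (3 / 2))" by (rule powr_minus[symmetric])
      finally show ?thesis by simp
    qed
    finally show ?case .
  qed
qed

text \<open>Both bounds come from comparing Stirling's crude estimate \<open>ln n! = n ln n + O(n)\<close> with the prime
  factorisation of \<open>n!\<close>. The multiplicity of \<open>p\<close> is at least \<open>n / p - 1\<close>, where the loss is controlled
  by Chebyshev's bound, and at most \<open>n / (p - 1)\<close>, which exceeds \<open>n / p\<close> by a summable amount.\<close>

lemma mertens_first:
  "\<exists>C. \<forall>n\<ge>1. \<bar>(\<Sum>p | prime p \<and> p \<le> n. ln (real p) / real p) - ln (real n)\<bar> \<le> C"
proof -
  define B where "B = (\<Sum>m. ln (real m) / (real m * (real m - 1)))"
  define A where "A n = (\<Sum>p | prime p \<and> p \<le> n. ln (real p) / real p)" for n :: nat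
  have fin: "finite {p. prime p \<and> p \<le> n}" for n :: nat by auto
  have upper: "A n \<le> ln (real n) + ln 4" if n: "n \<ge> 1" for n
  proof -
    have "real n * A n - real n * ln 4 \<le>
        real n * A n - (\<Sum>p | prime p \<and> p \<le> n. ln (real p))"
      using theta_le[of n] by simp
    also have "\<dots> = (\<Sum>p | prime p \<and> p \<le> n. (real n / real p - 1) * ln (real p))"
      by (simp add: A_def sum_distrib_left sum_subtractf[symmetric] algebra_simps)
    also have "\<dots> \<le> ln (fact n)"
      unfolding ln_fact_eq using n
      by (intro sum_mono mult_right_mono multiplicity_fact_bounds) (auto dest: prime_gt_0_nat simp: Suc_le_eq)
    also have "\<dots> \<le> ln (real n ^ n)"
      using fact_le_power[of n, where 'a=real] n by (subst ln_le_cancel_iff) auto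
    also have "\<dots> = real n * ln (real n)" using n by (simp add: ln_realpow)
    finally have "real n * A n \<le> real n * (ln (real n) + ln 4)" by (simp add: algebra_simps)
    then show ?thesis using n by simp
  qed
  have lower: "ln (real n) - 1 - B \<le> A n" if n: "n \<ge> 1" for n
  proof -
    have "real n * ln (real n) - real n \<le> ln (fact n)" by (rule ln_fact_ge[OF n])
    also have "\<dots> \<le> (\<Sum>p | prime p \<and> p \<le> n. real n / (real p - 1) * ln (real p))"
      unfolding ln_fact_eq using n
      by (intro sum_mono mult_right_mono multiplicity_fact_bounds) (auto dest: prime_gt_0_nat simp: Suc_le_eq)
    also have "\<dots> = real n * (\<Sum>p | prime p \<and> p \<le> n. ln (real p) / real p + ln (real p) / (real p * (real p - 1)))"
      unfolding sum_distrib_left by (intro sum.cong refl) (auto simp: field_simps dest: prime_gt_1_nat)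
    also have "\<dots> = real n * (A n + (\<Sum>p | prime p \<and> p \<le> n. ln (real p) / (real p * (real p - 1))))"
      by (simp add: A_def sum.distrib)
    also have "\<dots> \<le> real n * (A n + B)"
    proof (intro mult_left_mono add_left_mono)
      show "(\<Sum>p | prime p \<and> p \<le> n. ln (real p) / (real p * (real p - 1))) \<le> B"
        unfolding B_def
      proof (intro sum_le_suminf summable_ln_over_square fin ballI)
        fix m :: nat show "0 \<le> ln (real m) / (real m * (real m - 1))"
          by (cases "m = 0") auto
      qed
    qed auto
    finally have "real n * (ln (real n) - 1) \<le> real n * (A n + B)" by (simp add: algebra_simps)
    then show ?thesis using n by simp
  qed
  show ?thesis
    unfolding A_def[symmetric]
  proof (intro exI allI impI)
    fix n :: nat assume "n \<ge> 1"
    then show "\<bar>A n - ln (real n)\<bar> \<le> max (ln 4) (1 + B)"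
      using upper[of n] lower[of n] by linarith
  qed
qed

text \<open>Summation by parts. If the partial sums of \<open>a\<close> are \<open>l + R\<close> with bounded \<open>R\<close>, then
  \<open>\<Sum> a\<^sub>i / l\<^sub>i\<close> behaves like \<open>\<Sum> (l\<^sub>i - l\<^sub>i\<^sub>-\<^sub>1) / l\<^sub>i\<close>, a Riemann sum of \<open>\<integral> dl / l\<close>. All errors are dominated by
  the telescoping series of \<open>1 / l\<^sub>k - 1 / l\<^sub>k\<^sub>+\<^sub>1\<close>; for the Riemann sum this needs bounded gaps
  \<open>l\<^sub>k\<^sub>+\<^sub>1 - l\<^sub>k\<close>, which follow from the bounds on \<open>a\<close> and \<open>R\<close>.\<close>

lemma abel_summation_log_log:
  fixes a l :: "nat \<Rightarrow> real"
  assumes l: "\<And>k. 0 < l k" "\<And>k. l k \<le> l (Suc k)" "filterlim l at_top sequentially"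
    and A: "\<And>k. \<bar>(\<Sum>i\<le>k. a i) - l k\<bar> \<le> C" and a: "\<And>k. \<bar>a k\<bar> \<le> C"
  shows "convergent (\<lambda>k. (\<Sum>i\<le>k. a i / l i) - ln (l k))"
proof -
  define R where "R k = (\<Sum>i\<le>k. a i) - l k" for k
  define d where "d k = (\<Sum>i\<le>k. a i / l i) - ln (l k)" for k
  \<comment> \<open>subtracting the boundary term of the summation by parts makes the increments summable\<close>
  define E where "E k = d k - R k / l k" for k
  define t where "t k = 1 / l k" for k
  have aR: "a (Suc k) = l (Suc k) - l k + (R (Suc k) - R k)" for k by (simp add: R_def)
  have tlim: "t \<longlonglongrightarrow> 0"
    unfolding t_def by (rule tendsto_divide_0[OF tendsto_const filterlim_at_top_imp_at_infinity[OF l(3)]])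
  have sumt: "summable (\<lambda>k. 4 * C * (t k - t (Suc k)))"
    by (intro summable_mult telescope_summable'[OF tlim])
  have bound: "norm (E (Suc k) - E k) \<le> 4 * C * (t k - t (Suc k))" for k
  proof -
    define u where "u = (l (Suc k) - l k) / l (Suc k)"
    have lk: "l k > 0" "l (Suc k) > 0" "l k \<le> l (Suc k)" using l by auto
    have u: "1 - u = l k / l (Suc k)" "0 \<le> u" using lk by (auto simp: u_def field_simps)
    have eq: "E (Suc k) - E k = (u + ln (1 - u)) + R k * (t k - t (Suc k))"
    proof -
      have "E (Suc k) - E k = a (Suc k) / l (Suc k) - ln (l (Suc k)) + ln (l k)
          - R (Suc k) / l (Suc k) + R k / l k"
        by (simp add: E_def d_def)
      also have "\<dots> = (l (Suc k) - l k) / l (Suc k) + (ln (l k) - ln (l (Suc k))) + R k * (t k - t (Suc k))"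
        unfolding aR t_def using lk by (simp add: field_simps)
      also have "ln (l k) - ln (l (Suc k)) = ln (1 - u)"
        unfolding u using lk by (simp add: ln_div)
      finally show ?thesis by (simp add: u_def)
    qed
    have tt: "t k - t (Suc k) = (l (Suc k) - l k) / (l k * l (Suc k))" "0 \<le> t k - t (Suc k)"
      using lk by (auto simp: t_def field_simps)
    have "u + ln (1 - u) \<le> 0"
      unfolding u(1) using ln_le_minus_one[of "l k / l (Suc k)"] lk u(1) by simp
    moreover have "- (u + ln (1 - u)) \<le> 3 * C * (t k - t (Suc k))"
    proof -
      have "- ln (1 - u) = ln (l (Suc k) / l k)" unfolding u(1) using lk by (simp add: ln_div)
      also have "\<dots> \<le> l (Suc k) / l k - 1" using lk by (intro ln_le_minus_one) auto
      finally have "- (u + ln (1 - u)) \<le> l (Suc k) / l k - 1 - u" by simp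
      also have "\<dots> = (l (Suc k) - l k) * (t k - t (Suc k))"
        unfolding u_def tt(1) using lk by (simp add: field_simps)
      also have "\<dots> \<le> (3 * C) * (t k - t (Suc k))"
      proof (intro mult_right_mono tt)
        have "l (Suc k) - l k = a (Suc k) - (R (Suc k) - R k)" using aR[of k] by simp
        then show "l (Suc k) - l k \<le> 3 * C"
          using a[of "Suc k"] A[of k] A[of "Suc k"] unfolding R_def by linarith
      qed
      finally show ?thesis .
    qed
    moreover have "\<bar>R k * (t k - t (Suc k))\<bar> \<le> C * (t k - t (Suc k))"
      using A[of k] tt(2) by (simp add: abs_mult R_def mult_right_mono)
    ultimately show ?thesis unfolding eq real_norm_def by (simp add: algebra_simps abs_le_iff)
  qed
  have "summable (\<lambda>k. E (Suc k) - E k)"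
    by (rule summable_comparison_test'[OF sumt, of 0]) (use bound in auto)
  then have "convergent (\<lambda>n. \<Sum>k<n. E (Suc k) - E k)"
    by (simp add: summable_iff_convergent)
  then have "convergent (\<lambda>n. E n - E 0)" by (simp add: sum_lessThan_telescope)
  then have "convergent (\<lambda>n. (E n - E 0) + E 0)" by (intro convergent_add convergent_const)
  then have E: "convergent E" by simp
  have "(\<lambda>k. R k / l k) \<longlonglongrightarrow> 0"
  proof (rule Lim_null_comparison)
    show "\<forall>\<^sub>F k in sequentially. norm (R k / l k) \<le> C * t k"
      using A l(1) by (intro always_eventually) (auto simp: R_def t_def divide_right_mono less_imp_le abs_of_pos)
    show "(\<lambda>k. C * t k) \<longlonglongrightarrow> 0" using tendsto_mult_right_zero[OF tlim] by simp
  qed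
  then have "convergent (\<lambda>k. R k / l k)" by (rule convergentI)
  from convergent_add[OF E this] have "convergent d" by (simp add: E_def)
  then show ?thesis by (simp add: d_def[abs_def])
qed

lemma prime_nth_prime: "prime (nth_prime k)"
  unfolding nth_prime_def using enumerate_in_set[OF primes_infinite] by auto

lemma strict_mono_nth_prime: "strict_mono nth_prime"
  unfolding strict_mono_def nth_prime_def using enumerate_mono[OF _ primes_infinite] by blast

lemma nth_prime_ge: "k + 2 \<le> nth_prime k"
proof (induction k)
  case 0 then show ?case using prime_ge_2_nat[OF prime_nth_prime, of 0] by simp
next
  case (Suc k)
  have "nth_prime k < nth_prime (Suc k)" using strict_mono_nth_prime by (simp add: strict_mono_def)
  then show ?case using Suc by simp
qed

lemma primes_le_nth_prime: "{p. prime p \<and> p \<le> nth_prime k} = nth_prime ` {..k}"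
proof -
  have "\<exists>i\<le>k. p = nth_prime i" if p: "prime p" "p \<le> nth_prime k" for p
  proof -
    obtain i where i: "nth_prime i = p"
      using enumerate_Ex[OF primes_infinite, of p] p(1) unfolding nth_prime_def by auto
    then have "i \<le> k" using p strict_mono_less_eq[OF strict_mono_nth_prime] by blast
    then show ?thesis using i by auto
  qed
  then show ?thesis
    using prime_nth_prime strict_mono_less_eq[OF strict_mono_nth_prime] by auto
qed

lemma sum_primes_le_nth_prime: "(\<Sum>p | prime p \<and> p \<le> nth_prime k. f p) = (\<Sum>i\<le>k. f (nth_prime i))"
  unfolding primes_le_nth_prime
  by (subst sum.reindex) (auto intro!: inj_onI simp: strict_mono_eq[OF strict_mono_nth_prime])

lemma nth_prime_ge_2: "real (nth_prime k) \<ge> 2"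
  using nth_prime_ge[of k] by linarith

lemma ln_nth_prime_pos: "0 < ln (real (nth_prime k))"
  using nth_prime_ge_2[of k] by simp

lemma ln_nth_prime_less_iff:
  "ln (real (nth_prime i)) < ln (real (nth_prime j)) \<longleftrightarrow> i < j"
  using nth_prime_ge_2[of i] nth_prime_ge_2[of j] strict_mono_less[OF strict_mono_nth_prime, of i j] by simp

lemma filterlim_nth_prime: "filterlim (\<lambda>k. real (nth_prime k)) at_top sequentially"
  by (rule filterlim_at_top_mono[OF filterlim_real_sequentially])
    (auto intro!: always_eventually order.trans[OF _ nth_prime_ge])

lemma filterlim_ln_nth_prime: "filterlim (\<lambda>k. ln (real (nth_prime k))) at_top sequentially"
  by (rule filterlim_compose[OF ln_at_top filterlim_nth_prime])

lemma mertens_second: "convergent (\<lambda>k. (\<Sum>i\<le>k. 1 / real (nth_prime i)) - ln (ln (real (nth_prime k))))"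
proof -
  obtain C where C: "\<And>n. n \<ge> 1 \<Longrightarrow> \<bar>(\<Sum>p | prime p \<and> p \<le> n. ln (real p) / real p) - ln (real n)\<bar> \<le> C"
    using mertens_first by blast
  have "convergent (\<lambda>k. (\<Sum>i\<le>k. (ln (nth_prime i) / nth_prime i) / ln (nth_prime i)) - ln (ln (real (nth_prime k))))"
  proof (rule abel_summation_log_log[OF ln_nth_prime_pos _ filterlim_ln_nth_prime, where C = "max C 1"])
    fix k
    show "ln (real (nth_prime k)) \<le> ln (real (nth_prime (Suc k)))"
      using ln_nth_prime_less_iff[of k "Suc k"] by simp
    show "\<bar>(\<Sum>i\<le>k. ln (real (nth_prime i)) / real (nth_prime i)) - ln (real (nth_prime k))\<bar> \<le> max C 1"
      using C[of "nth_prime k"] nth_prime_ge[of k] by (simp add: sum_primes_le_nth_prime)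
    have "ln (real (nth_prime k)) \<le> real (nth_prime k)"
      using nth_prime_ge_2[of k] ln_le_minus_one[of "real (nth_prime k)"] by linarith
    then show "\<bar>ln (real (nth_prime k)) / real (nth_prime k)\<bar> \<le> max C 1"
      using nth_prime_ge_2[of k] by (auto simp: le_max_iff_disj)
  qed
  moreover have "(ln (nth_prime i) / nth_prime i) / ln (nth_prime i) = 1 / real (nth_prime i)" for i
    using nth_prime_ge_2[of i] by simp
  ultimately show ?thesis by simp
qed

definition euler_product :: "nat \<Rightarrow> real" where
  "euler_product k = (\<Prod>i<k. 1 / (1 - 1 / real (nth_prime i)))"

text \<open>Exponentiate \<open>mertens_second\<close>: \<open>- ln (1 - q)\<close> differs from \<open>q\<close> by \<open>O(q\<^sup>2)\<close>, which is summable over the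
  primes.\<close>

lemma mertens_third: "\<exists>c>0. (\<lambda>k. ln (real (nth_prime k)) / euler_product (Suc k)) \<longlonglongrightarrow> c"
proof -
  define q where "q i = 1 / real (nth_prime i)" for i
  have p2: "real (nth_prime k) \<ge> real k + 2" for k using nth_prime_ge[of k] by linarith
  have q: "0 < q i" "q i \<le> 1 / 2" "q i \<le> 1 / (real i + 1)" for i
    using p2[of i] by (auto simp: q_def field_simps)
  have "summable (\<lambda>i. - ln (1 - q i) - q i)"
  proof (rule summable_comparison_test_ev)
    have "summable (\<lambda>i. 1 / (real (Suc i))\<^sup>2)"
      using inverse_power_summable[of 2, where 'a=real] by (subst summable_Suc_iff) (simp add: field_simps)
    then show "summable (\<lambda>i. 2 * (1 / (real (Suc i))\<^sup>2))" by (rule summable_mult)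
    show "\<forall>\<^sub>F i in sequentially. norm (- ln (1 - q i) - q i) \<le> 2 * (1 / (real (Suc i))\<^sup>2)"
    proof (intro always_eventually allI)
      fix i
      have "\<bar>ln (1 + - q i) - - q i\<bar> \<le> 2 * (- q i)\<^sup>2"
        using q[of i] by (intro abs_ln_one_plus_x_minus_x_bound) auto
      also have "(- q i)\<^sup>2 \<le> (1 / (real i + 1))\<^sup>2"
        using q[of i] by (simp add: power_mono)
      finally show "norm (- ln (1 - q i) - q i) \<le> 2 * (1 / (real (Suc i))\<^sup>2)"
        by (simp add: power_one_over add.commute abs_if split: if_splits)
    qed
  qed
  then have "convergent (\<lambda>n. \<Sum>i<n. - ln (1 - q i) - q i)" by (simp add: summable_iff_convergent)
  then have "convergent (\<lambda>n. \<Sum>i<Suc n. - ln (1 - q i) - q i)"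
    by (subst convergent_Suc_iff)
  from convergent_add[OF this mertens_second]
  have "convergent (\<lambda>k. (\<Sum>i\<le>k. - ln (1 - q i)) - ln (ln (real (nth_prime k))))"
    by (simp add: lessThan_Suc_atMost sum_subtractf q_def)
  then obtain c where "(\<lambda>k. (\<Sum>i\<le>k. - ln (1 - q i)) - ln (ln (real (nth_prime k)))) \<longlonglongrightarrow> c"
    by (auto simp: convergent_def)
  then have "(\<lambda>k. exp (- ((\<Sum>i\<le>k. - ln (1 - q i)) - ln (ln (real (nth_prime k)))))) \<longlonglongrightarrow> exp (- c)"
    by (intro tendsto_exp tendsto_minus)
  moreover have "exp (- ((\<Sum>i\<le>k. - ln (1 - q i)) - ln (ln (real (nth_prime k))))) =
      ln (real (nth_prime k)) / euler_product (Suc k)" for k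
  proof -
    have "exp (- ((\<Sum>i\<le>k. - ln (1 - q i)) - ln (ln (real (nth_prime k))))) =
        exp (ln (ln (real (nth_prime k)))) * exp (\<Sum>i\<le>k. ln (1 - q i))"
      by (simp add: exp_add[symmetric] sum_negf)
    also have "exp (ln (ln (real (nth_prime k)))) = ln (real (nth_prime k))"
      using p2[of k] by simp
    also have "exp (\<Sum>i\<le>k. ln (1 - q i)) = (\<Prod>i\<le>k. 1 - q i)"
    proof -
      have "exp (ln (1 - q i)) = 1 - q i" for i using q(2)[of i] by (intro exp_ln) linarith
      then show ?thesis by (simp add: exp_sum)
    qed
    also have "\<dots> = 1 / euler_product (Suc k)"
      by (simp add: euler_product_def q_def lessThan_Suc_atMost prod_dividef)
    finally show ?thesis by simp
  qed
  ultimately show ?thesis by (intro exI[of _ "exp (- c)"]) auto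
qed

section \<open>Cells of the Euler product and atoms of the prime process\<close>

definition prime_point :: "nat \<Rightarrow> nat \<Rightarrow> real" where
  "prime_point n k = ln (real (nth_prime k)) / ln (real (nth_prime n))"

text \<open>The ratio of the endpoints of cell \<open>k\<close> is \<open>1 / (1 - 1 / p\<^sub>k)\<close> for every \<open>n\<close>; the normalisation makes the
  cells \<open>0, \<dots>, n\<close> end exactly at \<open>1\<close>, as the atoms \<open>0, \<dots>, n\<close> do.\<close>

definition cell :: "nat \<Rightarrow> nat \<Rightarrow> real set" where
  "cell n k = {euler_product k / euler_product (Suc n) <.. euler_product (Suc k) / euler_product (Suc n)}"

definition cell_index :: "nat \<Rightarrow> real \<Rightarrow> nat" where
  "cell_index n t = (LEAST k. t * euler_product (Suc n) \<le> euler_product (Suc k))"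

lemma prime_point_pos: "0 < prime_point n k"
  by (simp add: prime_point_def ln_nth_prime_pos)

lemma prime_point_le_1_iff: "prime_point n k \<le> 1 \<longleftrightarrow> k \<le> n"
  using ln_nth_prime_pos[of n] ln_nth_prime_less_iff[of n k]
  by (auto simp: prime_point_def field_simps not_less[symmetric])

lemma finite_prime_point_le: "finite {k. prime_point n k \<le> b}"
proof -
  have "eventually (\<lambda>k. b * ln (real (nth_prime n)) < ln (real (nth_prime k))) sequentially"
    using filterlim_ln_nth_prime by (simp add: filterlim_at_top_dense)
  then obtain m where m: "\<And>k. k \<ge> m \<Longrightarrow> b * ln (real (nth_prime n)) < ln (real (nth_prime k))"
    by (auto simp: eventually_sequentially)
  have "{k. prime_point n k \<le> b} \<subseteq> {..<m}"
  proof
    fix k assume "k \<in> {k. prime_point n k \<le> b}"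
    then have "ln (real (nth_prime k)) \<le> b * ln (real (nth_prime n))"
      using ln_nth_prime_pos[of n] by (simp add: prime_point_def field_simps)
    then show "k \<in> {..<m}" using m[of k] by (simp add: not_le[symmetric]) (use not_less in blast)
  qed
  then show ?thesis using finite_subset by blast
qed

lemma prime_point_tendsto_0: "(\<lambda>n. prime_point n k) \<longlonglongrightarrow> 0"
  unfolding prime_point_def
  by (rule tendsto_divide_0[OF tendsto_const filterlim_at_top_imp_at_infinity[OF filterlim_ln_nth_prime]])

lemma euler_product_0: "euler_product 0 = 1"
  by (simp add: euler_product_def)

lemma euler_product_Suc: "euler_product (Suc k) = euler_product k / (1 - 1 / real (nth_prime k))"
  by (simp add: euler_product_def)

lemma euler_product_pos: "0 < euler_product k"
  unfolding euler_product_def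
proof (intro prod_pos ballI)
  fix i show "0 < 1 / (1 - 1 / real (nth_prime i))" using nth_prime_ge_2[of i] by simp
qed

lemma strict_mono_euler_product: "strict_mono euler_product"
proof (rule strict_monoI_Suc)
  fix k
  have "euler_product k * (1 - 1 / real (nth_prime k)) < euler_product k * 1"
    using nth_prime_ge_2[of k] euler_product_pos[of k] by (intro mult_strict_left_mono) auto
  then show "euler_product k < euler_product (Suc k)"
    unfolding euler_product_Suc using nth_prime_ge_2[of k] by (simp add: field_simps)
qed

lemma euler_product_Suc_le: "euler_product (Suc k) \<le> 2 * euler_product k"
proof -
  have "1 / 2 \<le> 1 - 1 / real (nth_prime k)" using nth_prime_ge_2[of k] by (simp add: field_simps)
  then have "euler_product k / (1 - 1 / real (nth_prime k)) \<le> euler_product k / (1 / 2)"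
    using euler_product_pos[of k] by (intro divide_left_mono) auto
  then show ?thesis by (simp add: euler_product_Suc)
qed

lemma filterlim_euler_product: "filterlim euler_product at_top sequentially"
proof -
  obtain c where c: "c > 0" "(\<lambda>k. ln (real (nth_prime k)) / euler_product (Suc k)) \<longlonglongrightarrow> c"
    using mertens_third by blast
  have "filterlim (\<lambda>k. inverse (ln (real (nth_prime k)) / euler_product (Suc k)) * ln (real (nth_prime k))) at_top sequentially"
    by (rule filterlim_tendsto_pos_mult_at_top[OF tendsto_inverse[OF c(2)] _ filterlim_ln_nth_prime]) (use c in auto)
  moreover have "inverse (ln (real (nth_prime k)) / euler_product (Suc k)) * ln (real (nth_prime k)) = euler_product (Suc k)" for k
    using ln_nth_prime_pos[of k] by (simp add: field_simps)
  ultimately show ?thesis by (simp add: filterlim_sequentially_Suc)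
qed

lemma mem_cell_iff:
  "t \<in> cell n k \<longleftrightarrow> euler_product k < t * euler_product (Suc n) \<and> t * euler_product (Suc n) \<le> euler_product (Suc k)"
  using euler_product_pos[of "Suc n"] by (auto simp: cell_def field_simps)

lemma cell_index_eq: "t \<in> cell n k \<Longrightarrow> cell_index n t = k"
  unfolding cell_index_def mem_cell_iff
  using strict_mono_less_eq[OF strict_mono_euler_product]
  by (intro Least_equality) (auto, meson leD le_less_trans not_less_eq_eq order.trans)

lemma mem_cell_index:
  assumes "1 < t * euler_product (Suc n)"
  shows "t \<in> cell n (cell_index n t)"
proof -
  let ?P = "\<lambda>k. t * euler_product (Suc n) \<le> euler_product (Suc k)"
  have "eventually (\<lambda>k. t * euler_product (Suc n) \<le> euler_product k) sequentially"
    using filterlim_euler_product by (simp add: filterlim_at_top)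
  then obtain m where "\<And>k. k \<ge> m \<Longrightarrow> t * euler_product (Suc n) \<le> euler_product k"
    by (auto simp: eventually_sequentially)
  then have "?P m" by simp
  then have P: "?P (cell_index n t)" unfolding cell_index_def by (rule LeastI)
  have "euler_product (cell_index n t) < t * euler_product (Suc n)"
  proof (cases "cell_index n t")
    case 0
    then show ?thesis using assms by (simp add: euler_product_0)
  next
    case (Suc j)
    then have "\<not> ?P j" using not_less_Least[of j ?P] unfolding cell_index_def by simp
    then show ?thesis using Suc by simp
  qed
  then show ?thesis using P by (simp add: mem_cell_iff)
qed

lemma disjoint_family_cell: "disjoint_family (cell n)"
  using cell_index_eq unfolding disjoint_family_on_def by blast

lemma cell_index_at_top:
  assumes "t > 0"
  shows "filterlim (\<lambda>n. cell_index n t) at_top sequentially"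
    and "eventually (\<lambda>n. t \<in> cell n (cell_index n t)) sequentially"
proof -
  have lim: "filterlim (\<lambda>n. t * euler_product (Suc n)) at_top sequentially"
    using filterlim_euler_product
    by (intro filterlim_tendsto_pos_mult_at_top[OF tendsto_const assms]) (simp add: filterlim_sequentially_Suc)
  have "eventually (\<lambda>n. 1 < t * euler_product (Suc n)) sequentially"
    using lim by (simp add: filterlim_at_top_dense)
  then show "eventually (\<lambda>n. t \<in> cell n (cell_index n t)) sequentially"
    by eventually_elim (rule mem_cell_index)
  show "filterlim (\<lambda>n. cell_index n t) at_top sequentially"
    unfolding filterlim_at_top
  proof
    fix K
    have "eventually (\<lambda>n. 1 < t * euler_product (Suc n) \<and> euler_product K < t * euler_product (Suc n)) sequentially"
      using lim by (intro eventually_conj) (auto simp: filterlim_at_top_dense)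
    then show "eventually (\<lambda>n. K \<le> cell_index n t) sequentially"
    proof eventually_elim
      case (elim n)
      then have "t \<in> cell n (cell_index n t)" using mem_cell_index by blast
      then have "euler_product K < euler_product (Suc (cell_index n t))"
        using elim by (simp add: mem_cell_iff)
      then show ?case using strict_mono_less[OF strict_mono_euler_product] by simp
    qed
  qed
qed

text \<open>Moving \<open>t\<close> to the atom of its cell multiplies it by a quotient of two late terms of the convergent
  sequence \<open>ln p\<^sub>k / V\<^sub>k\<^sub>+\<^sub>1\<close>, and by at most the ratio of the endpoints of the cell; both tend to \<open>1\<close>.\<close>

lemma prime_point_cell_index_tendsto:
  assumes t: "t > 0"
  shows "(\<lambda>n. prime_point n (cell_index n t)) \<longlonglongrightarrow> t"
proof -
  define r where "r k = ln (real (nth_prime k)) / euler_product (Suc k)" for k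
  obtain c where c: "c > 0" "r \<longlonglongrightarrow> c"
    using mertens_third unfolding r_def by blast
  define \<rho> where "\<rho> n = euler_product (Suc (cell_index n t)) / euler_product (Suc n)" for n
  have "(\<lambda>n. r (cell_index n t) / r n) \<longlonglongrightarrow> c / c"
    using c by (intro tendsto_divide filterlim_compose[OF c(2) cell_index_at_top(1)[OF t]]) auto
  moreover have "\<rho> \<longlonglongrightarrow> t"
  proof (rule tendsto_sandwich)
    show "eventually (\<lambda>n. t \<le> \<rho> n) sequentially"
      using cell_index_at_top(2)[OF t] by eventually_elim (simp add: cell_def \<rho>_def)
    show "eventually (\<lambda>n. \<rho> n \<le> t / (1 - 1 / real (nth_prime (cell_index n t)))) sequentially"
      using cell_index_at_top(2)[OF t]
    proof eventually_elim
      case (elim n)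
      have "0 < 1 - 1 / real (nth_prime (cell_index n t))" using nth_prime_ge_2[of "cell_index n t"] by simp
      moreover have "\<rho> n = (euler_product (cell_index n t) / euler_product (Suc n)) / (1 - 1 / real (nth_prime (cell_index n t)))"
        by (simp add: \<rho>_def euler_product_Suc[of "cell_index n t"])
      moreover have "euler_product (cell_index n t) / euler_product (Suc n) \<le> t"
        using elim by (simp add: cell_def)
      ultimately show ?case by (simp only: divide_right_mono less_imp_le)
    qed
    have "(\<lambda>n. 1 / real (nth_prime (cell_index n t))) \<longlonglongrightarrow> 0"
      by (rule tendsto_divide_0[OF tendsto_const filterlim_at_top_imp_at_infinity])
        (rule filterlim_compose[OF filterlim_nth_prime cell_index_at_top(1)[OF t]])
    then have "(\<lambda>n. t / (1 - 1 / real (nth_prime (cell_index n t)))) \<longlonglongrightarrow> t / (1 - 0)"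
      by (intro tendsto_intros) auto
    then show "(\<lambda>n. t / (1 - 1 / real (nth_prime (cell_index n t)))) \<longlonglongrightarrow> t" by simp
    show "(\<lambda>_. t) \<longlonglongrightarrow> t" by simp
  qed
  ultimately have "(\<lambda>n. r (cell_index n t) / r n * \<rho> n) \<longlonglongrightarrow> c / c * t" by (rule tendsto_mult)
  moreover have "r (cell_index n t) / r n * \<rho> n = prime_point n (cell_index n t)" for n
    using euler_product_pos[of "Suc n"] euler_product_pos[of "Suc (cell_index n t)"] ln_nth_prime_pos[of n]
    by (simp add: r_def \<rho>_def prime_point_def field_simps)
  ultimately show ?thesis using c by simp
qed

text \<open>The uniform version of the preceding limit, which supplies the integrable majorant for dominated
  convergence: a positive convergent sequence with positive limit is bounded away from \<open>0\<close> and \<open>\<infinity>\<close>.\<close>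

lemma prime_point_cell_bounds:
  "\<exists>a>0. \<exists>b>0. \<forall>n k t. t \<in> cell n k \<longrightarrow> a * t \<le> prime_point n k \<and> prime_point n k \<le> b * t"
proof -
  define r where "r k = ln (real (nth_prime k)) / euler_product (Suc k)" for k
  obtain c where c: "c > 0" "r \<longlonglongrightarrow> c"
    using mertens_third unfolding r_def by blast
  have rpos: "r k > 0" for k by (simp add: r_def ln_nth_prime_pos euler_product_pos)
  have "Bseq r" using c by (intro convergent_imp_Bseq convergentI)
  then obtain u where u: "u > 0" "\<And>k. r k \<le> u" using rpos unfolding Bseq_def by (auto simp: abs_of_pos)
  have "Bseq (\<lambda>k. inverse (r k))" using c by (intro convergent_imp_Bseq convergentI[OF tendsto_inverse]) auto
  then obtain v where v: "v > 0" "\<And>k. inverse (r k) \<le> v" using rpos unfolding Bseq_def by (auto simp: abs_of_pos)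
  have v': "1 / v \<le> r k" for k using v(1) v(2)[of k] rpos[of k] by (simp add: field_simps)
  have "(1 / (v * u)) * t \<le> prime_point n k \<and> prime_point n k \<le> (2 * u * v) * t" if t: "t \<in> cell n k" for n k t
  proof -
    define \<rho> where "\<rho> = euler_product (Suc k) / euler_product (Suc n)"
    have "\<rho> \<le> 2 * (euler_product k / euler_product (Suc n))"
      using euler_product_Suc_le[of k] euler_product_pos[of "Suc n"] by (simp add: \<rho>_def divide_right_mono)
    then have \<rho>: "t \<le> \<rho>" "\<rho> \<le> 2 * t" using t by (auto simp: cell_def \<rho>_def)
    have \<rho>0: "\<rho> > 0" by (simp add: \<rho>_def euler_product_pos)
    have x: "prime_point n k = (r k * inverse (r n)) * \<rho>"
      using euler_product_pos[of "Suc n"] euler_product_pos[of "Suc k"] ln_nth_prime_pos[of n]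
      by (simp add: r_def \<rho>_def prime_point_def field_simps)
    have u': "1 / u \<le> inverse (r n)" using u(1) u(2)[of n] rpos[of n] by (simp add: field_simps)
    have "t > 0" using t euler_product_pos by (force simp: cell_def intro: less_trans[rotated])
    then have "(1 / v) * (1 / u) * t \<le> (r k * inverse (r n)) * \<rho>"
      using \<rho> u v u' v'[of k] rpos[of k] rpos[of n] by (intro mult_mono) (auto simp: less_imp_le)
    moreover have "(r k * inverse (r n)) * \<rho> \<le> (u * v) * (2 * t)"
      using u v \<rho> \<rho>0 rpos[of k] rpos[of n] by (intro mult_mono) (auto simp: less_imp_le)
    ultimately show ?thesis unfolding x by (simp add: mult_ac)
  qed
  then show ?thesis
    using u v by (intro exI[of _ "1 / (v * u)"] exI[of _ "2 * u * v"] conjI) auto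
qed

lemma Ioc_in_pos_borel: "0 \<le> a \<Longrightarrow> {a<..b} \<in> sets pos_borel"
  by (auto simp: pos_borel_def sets_restrict_space_iff)

lemma cell_in_pos_borel: "cell n k \<in> sets pos_borel"
  unfolding cell_def using euler_product_pos[of k] euler_product_pos[of "Suc n"]
  by (intro Ioc_in_pos_borel) simp

text \<open>The pathwise limit. With the masses of the cells as weights, the sum is the integral of the step
  function that takes on each cell the value of \<open>\<phi>\<close> at its atom; it converges to \<open>\<phi>\<close> wherever \<open>\<phi>\<close> is
  continuous. The weights with index below \<open>K\<close> are arbitrary, because their atoms tend to \<open>0\<close> and \<open>\<phi>\<close> is
  small there.\<close>

lemma weighted_sum_prime_points_tendsto:
  fixes \<mu> :: "real measure" and \<phi> :: "real \<Rightarrow> real"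
  assumes space: "space \<mu> = {0<..}" and sets: "sets \<mu> = sets pos_borel"
    and fin: "\<And>a b. 0 < a \<Longrightarrow> emeasure \<mu> {a..b} < \<infinity>"
    and int1: "integrable \<mu> (\<lambda>t. indicator {..1} t * t)"
    and Y: "\<And>n k. emeasure \<mu> (cell n k) = of_nat (Y n k)"
    and meas: "\<phi> \<in> borel_measurable \<mu>"
    and le: "\<And>t. 0 < t \<Longrightarrow> \<bar>\<phi> t\<bar> \<le> A * t" and vanish: "\<And>t. b < t \<Longrightarrow> \<phi> t = 0"
    and cont: "AE t in \<mu>. isCont \<phi> t"
  shows "(\<lambda>n. \<Sum>k | prime_point n k \<le> b. real (if k < K then w k else Y n k) * \<phi> (prime_point n k))
    \<longlonglongrightarrow> (LINT t|\<mu>. \<phi> t)"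
proof -
  define F where "F n = {k. prime_point n k \<le> b}" for n
  have finF: "finite (F n)" for n unfolding F_def by (rule finite_prime_point_le)
  have A0: "0 \<le> A" using le[of 1] by simp
  have cell_sets: "cell n k \<in> sets \<mu>" for n k
    unfolding sets by (rule cell_in_pos_borel)
  have mY: "measure \<mu> (cell n k) = real (Y n k)" for n k by (simp add: measure_def Y)
  obtain c C where cC: "c > 0" "C > 0"
    "\<And>n k t. t \<in> cell n k \<Longrightarrow> c * t \<le> prime_point n k"
    "\<And>n k t. t \<in> cell n k \<Longrightarrow> prime_point n k \<le> C * t"
    using prime_point_cell_bounds by blast
  \<comment> \<open>the step function that moves each \<open>t\<close> to the atom of its cell before \<open>\<phi>\<close> is applied\<close>
  define h where "h n t = (\<Sum>k\<in>F n - {..<K}. indicator (cell n k) t * \<phi> (prime_point n k))" for n t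
  have h_eq: "h n t = (if k \<in> F n - {..<K} then \<phi> (prime_point n k) else 0)" if "t \<in> cell n k" for n t k
  proof -
    have uniq: "j = k" if "t \<in> cell n j" for j
      using cell_index_eq[OF that] cell_index_eq[OF \<open>t \<in> cell n k\<close>] by simp
    have "h n t = (\<Sum>j\<in>F n - {..<K}. if j = k then \<phi> (prime_point n k) else 0)"
      unfolding h_def
    proof (rule sum.cong[OF refl])
      fix j
      show "indicator (cell n j) t * \<phi> (prime_point n j) = (if j = k then \<phi> (prime_point n k) else 0)"
        using that uniq[of j] by (cases "t \<in> cell n j") auto
    qed
    then show ?thesis using finF by (simp add: sum.delta)
  qed
  have h_bound: "norm (h n t) \<le> A * C * (indicator {..b / c} t * t)" if "t \<in> space \<mu>" for n t
  proof (cases "\<exists>k. t \<in> cell n k")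
    case True
    then obtain k where k: "t \<in> cell n k" by auto
    have t: "t > 0" using that space by auto
    show ?thesis
    proof (cases "k \<in> F n - {..<K}")
      case True
      have "t \<le> b / c" using True cC(1) cC(3)[OF k] by (auto simp: F_def field_simps)
      moreover have "\<bar>\<phi> (prime_point n k)\<bar> \<le> A * (C * t)"
        using le[OF prime_point_pos[of n k]] mult_left_mono[OF cC(4)[OF k] A0] by linarith
      ultimately show ?thesis using True h_eq[OF k] by (simp add: mult_ac)
    next
      case False
      have "h n t = 0" using h_eq[OF k] False by (simp only: if_False)
      then show ?thesis using A0 cC t by (simp add: indicator_def)
    qed
  next
    case False
    then have "h n t = 0" unfolding h_def by (intro sum.neutral) auto
    then show ?thesis using A0 cC that space by (simp add: indicator_def)
  qed
  have dom: "integrable \<mu> (\<lambda>t. A * C * (indicator {..b / c} t * t))"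
  proof (intro integrable_mult_right)
    have id: "(\<lambda>t. t) \<in> borel_measurable \<mu>"
      by (subst measurable_cong_sets[OF sets refl]) (simp add: pos_borel_def measurable_restrict_space1)
    have S: "{1..b / c} \<in> sets \<mu>" unfolding sets pos_borel_def by (auto simp: sets_restrict_space_iff)
    have S': "{..b / c} \<inter> {0<..} \<in> sets \<mu>" unfolding sets pos_borel_def by (auto simp: sets_restrict_space_iff)
    have "integrable \<mu> (\<lambda>t. indicator {..1} t * t + max 0 (b / c) * indicator {1..b / c} t)"
      using fin[of 1 "b / c"] S
      by (intro Bochner_Integration.integrable_add int1 integrable_mult_right integrable_real_indicator) auto
    then show "integrable \<mu> (\<lambda>t. indicator {..b / c} t * t)"
    proof (rule Bochner_Integration.integrable_bound)
      have "(\<lambda>t. indicator ({..b / c} \<inter> {0<..}) t * t) \<in> borel_measurable \<mu>"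
        using id S' by measurable
      then show "(\<lambda>t. indicator {..b / c} t * t) \<in> borel_measurable \<mu>"
        by (rule subst[OF measurable_cong, rotated]) (auto simp: space indicator_def)
    qed (auto intro!: AE_I2 simp: space indicator_def)
  qed
  have "(\<lambda>n. LINT t|\<mu>. h n t) \<longlonglongrightarrow> (LINT t|\<mu>. \<phi> t)"
  proof (rule integral_dominated_convergence[OF meas _ dom])
    show "h n \<in> borel_measurable \<mu>" for n
      unfolding h_def using cell_sets by measurable
    show "AE t in \<mu>. norm (h n t) \<le> A * C * (indicator {..b / c} t * t)" for n
      using h_bound by (rule AE_I2)
    show "AE t in \<mu>. (\<lambda>n. h n t) \<longlonglongrightarrow> \<phi> t"
      using cont AE_space
    proof eventually_elim
      case (elim t)
      then have t: "t > 0" using space by auto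
      have "(\<lambda>n. \<phi> (prime_point n (cell_index n t))) \<longlonglongrightarrow> \<phi> t"
        using isCont_tendsto_compose[OF elim(1) prime_point_cell_index_tendsto[OF t]] .
      moreover have "eventually (\<lambda>n. \<phi> (prime_point n (cell_index n t)) = h n t) sequentially"
        using cell_index_at_top(2)[OF t] filterlim_at_top[THEN iffD1, OF cell_index_at_top(1)[OF t], rule_format, of K]
      proof eventually_elim
        case (elim n)
        then show ?case using h_eq[OF elim(1)] vanish by (auto simp: F_def not_le)
      qed
      ultimately show ?case by (rule Lim_transform_eventually)
    qed
  qed
  moreover have "integrable \<mu> (indicat_real (cell n k))" for n k
    by (rule integrable_real_indicator[OF cell_sets]) (simp add: Y of_nat_less_top)
  then have "(LINT t|\<mu>. h n t) = (\<Sum>k\<in>F n - {..<K}. real (Y n k) * \<phi> (prime_point n k))" for n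
    unfolding h_def using cell_sets
    by (subst Bochner_Integration.integral_sum) (auto simp: mY Y sets.Int_space_eq2 intro!: integrable_mult_left)
  ultimately have main: "(\<lambda>n. \<Sum>k\<in>F n - {..<K}. real (Y n k) * \<phi> (prime_point n k)) \<longlonglongrightarrow> (LINT t|\<mu>. \<phi> t)"
    by simp
  have small: "(\<lambda>n. \<Sum>k<K. of_bool (k \<in> F n) * real (w k) * \<phi> (prime_point n k)) \<longlonglongrightarrow> 0"
  proof (rule tendsto_null_sum)
    fix k
    show "(\<lambda>n. of_bool (k \<in> F n) * real (w k) * \<phi> (prime_point n k)) \<longlonglongrightarrow> 0"
    proof (rule Lim_null_comparison)
      show "(\<lambda>n. real (w k) * A * prime_point n k) \<longlonglongrightarrow> 0"
        using tendsto_mult_right_zero[OF prime_point_tendsto_0] .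
      show "eventually (\<lambda>n. norm (of_bool (k \<in> F n) * real (w k) * \<phi> (prime_point n k))
          \<le> real (w k) * A * prime_point n k) sequentially"
        using le[OF prime_point_pos] prime_point_pos A0
        by (intro always_eventually allI) (auto simp: abs_mult mult.assoc mult_left_mono less_imp_le)
    qed
  qed
  have split: "(\<Sum>k\<in>F n. real (if k < K then w k else Y n k) * \<phi> (prime_point n k)) =
      (\<Sum>k<K. of_bool (k \<in> F n) * real (w k) * \<phi> (prime_point n k)) +
      (\<Sum>k\<in>F n - {..<K}. real (Y n k) * \<phi> (prime_point n k))" for n
  proof -
    have "(\<Sum>k\<in>F n. real (if k < K then w k else Y n k) * \<phi> (prime_point n k)) =
       (\<Sum>k\<in>F n \<inter> {..<K}. real (if k < K then w k else Y n k) * \<phi> (prime_point n k)) +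
       (\<Sum>k\<in>F n - {..<K}. real (if k < K then w k else Y n k) * \<phi> (prime_point n k))"
      by (rule sum.Int_Diff[OF finF])
    also have "(\<Sum>k\<in>F n \<inter> {..<K}. real (if k < K then w k else Y n k) * \<phi> (prime_point n k)) =
        (\<Sum>k<K. of_bool (k \<in> F n) * real (w k) * \<phi> (prime_point n k))"
      by (rule sum.mono_neutral_cong_left) auto
    also have "(\<Sum>k\<in>F n - {..<K}. real (if k < K then w k else Y n k) * \<phi> (prime_point n k)) =
        (\<Sum>k\<in>F n - {..<K}. real (Y n k) * \<phi> (prime_point n k))"
      by (intro sum.cong) auto
    finally show ?thesis .
  qed
  show ?thesis
    using tendsto_add[OF small main] unfolding F_def[symmetric] split by simp
qed

section \<open>Exchanging independent weights\<close>

lemma abs_integral_diff_le: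
  fixes u v :: "'a \<Rightarrow> real"
  assumes M: "prob_space M" and m: "u \<in> borel_measurable M" "v \<in> borel_measurable M"
    and b: "\<And>\<omega>. \<omega> \<in> space M \<Longrightarrow> \<bar>u \<omega>\<bar> \<le> B" "\<And>\<omega>. \<omega> \<in> space M \<Longrightarrow> \<bar>v \<omega>\<bar> \<le> B"
    and A: "A \<in> sets M" and eq: "\<And>\<omega>. \<omega> \<in> space M \<Longrightarrow> \<omega> \<notin> A \<Longrightarrow> u \<omega> = v \<omega>"
  shows "\<bar>(LINT \<omega>|M. u \<omega>) - (LINT \<omega>|M. v \<omega>)\<bar> \<le> 2 * B * measure M A"
proof -
  interpret prob_space M by fact
  have iu: "integrable M u" by (rule integrable_const_bound[of _ B]) (auto intro!: AE_I2 b m)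
  have iv: "integrable M v" by (rule integrable_const_bound[of _ B]) (auto intro!: AE_I2 b m)
  have "\<bar>(LINT \<omega>|M. u \<omega>) - (LINT \<omega>|M. v \<omega>)\<bar> = norm (LINT \<omega>|M. u \<omega> - v \<omega>)"
    using iu iv by simp
  also have "\<dots> \<le> (LINT \<omega>|M. norm (u \<omega> - v \<omega>))" by (rule integral_norm_bound)
  also have "\<dots> \<le> (LINT \<omega>|M. (2 * B) * indicator A \<omega>)"
  proof (rule integral_mono)
    show "integrable M (\<lambda>\<omega>. norm (u \<omega> - v \<omega>))" using iu iv by auto
    show "integrable M (\<lambda>\<omega>. (2 * B) * indicator A \<omega>)"
      using A by (intro integrable_mult_right integrable_real_indicator) (auto simp: less_top[symmetric])
    fix \<omega> assume w: "\<omega> \<in> space M"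
    show "norm (u \<omega> - v \<omega>) \<le> 2 * B * indicator A \<omega>"
      using b[OF w] eq[OF w] by (auto simp: indicator_def)
  qed
  also have "\<dots> = 2 * B * measure M A" using A by simp
  finally show ?thesis .
qed

abbreviation nat_seqs :: "(nat \<Rightarrow> nat) measure" where
  "nat_seqs \<equiv> PiM UNIV (\<lambda>_. count_space UNIV)"

lemma (in prob_space) indep_prob_inter:
  assumes "indep_vars (\<lambda>_. count_space UNIV) X J" "finite J"
  shows "prob {\<omega>\<in>space M. \<forall>j\<in>J. X j \<omega> \<in> A j} = (\<Prod>j\<in>J. prob {\<omega>\<in>space M. X j \<omega> \<in> A j})"
proof (cases "J = {}")
  case True
  then show ?thesis using prob_space by simp
next
  case False
  have "{\<omega>\<in>space M. \<forall>j\<in>J. X j \<omega> \<in> A j} = (\<Inter>j\<in>J. X j -` A j \<inter> space M)"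
    using False by auto
  moreover have "{\<omega>\<in>space M. X j \<omega> \<in> A j} = X j -` A j \<inter> space M" for j by auto
  ultimately show ?thesis
    using indep_varsD_finite[OF assms(1) False assms(2), of A] by simp
qed

text \<open>Both sides give the same probability to every finite-dimensional rectangle, namely the product of the
  marginal probabilities.\<close>

lemma distr_independent_splice:
  fixes X :: "nat \<Rightarrow> 'a \<Rightarrow> nat" and U :: "nat \<Rightarrow> 'b \<Rightarrow> nat"
  assumes M: "prob_space M" and N: "prob_space N"
    and mX[measurable]: "\<And>k. X k \<in> M \<rightarrow>\<^sub>M count_space UNIV"
    and mU[measurable]: "\<And>k. U k \<in> N \<rightarrow>\<^sub>M count_space UNIV"
    and X: "\<And>J. finite J \<Longrightarrow> prob_space.indep_vars M (\<lambda>_. count_space UNIV) X J"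
    and U: "\<And>J. finite J \<Longrightarrow> prob_space.indep_vars N (\<lambda>_. count_space UNIV) U J"
    and eq: "\<And>k A. k \<notin> I \<Longrightarrow>
      measure M {\<omega>\<in>space M. X k \<omega> \<in> A} = measure N {\<omega>\<in>space N. U k \<omega> \<in> A}"
  shows "distr M nat_seqs (\<lambda>\<omega> k. X k \<omega>) =
    distr (M \<Otimes>\<^sub>M N) nat_seqs (\<lambda>(\<omega>, \<omega>') k. if k \<in> I then X k \<omega> else U k \<omega>')"
proof (rule measure_eqI_PiM_infinite[where I = UNIV and M = "\<lambda>_. count_space UNIV"])
  interpret M: prob_space M by fact
  interpret N: prob_space N by fact
  interpret MN: pair_prob_space M N ..
  have m1[measurable]: "(\<lambda>\<omega> k. X k \<omega>) \<in> M \<rightarrow>\<^sub>M nat_seqs"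
    by (rule measurable_PiM_single') auto
  have m2[measurable]: "(\<lambda>(\<omega>, \<omega>') k. if k \<in> I then X k \<omega> else U k \<omega>') \<in> M \<Otimes>\<^sub>M N \<rightarrow>\<^sub>M nat_seqs"
  proof (rule measurable_PiM_single')
    fix k show "(\<lambda>\<omega>. (case \<omega> of (\<omega>, \<omega>') \<Rightarrow> \<lambda>k. if k \<in> I then X k \<omega> else U k \<omega>') k)
        \<in> M \<Otimes>\<^sub>M N \<rightarrow>\<^sub>M count_space UNIV"
      by (cases "k \<in> I") (simp_all add: case_prod_beta)
  qed auto
  show "sets (distr M nat_seqs (\<lambda>\<omega> k. X k \<omega>)) = sets nat_seqs" by simp
  show "sets (distr (M \<Otimes>\<^sub>M N) nat_seqs (\<lambda>(\<omega>, \<omega>') k. if k \<in> I then X k \<omega> else U k \<omega>')) = sets nat_seqs"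
    by simp
  show "finite_measure (distr M nat_seqs (\<lambda>\<omega> k. X k \<omega>))"
    by (intro prob_space.finite_measure M.prob_space_distr m1)
  fix A :: "nat \<Rightarrow> nat set" and J :: "nat set" assume J: "finite J"
  have emb: "prod_emb UNIV (\<lambda>_. count_space UNIV) J (Pi\<^sub>E J A) = {w. \<forall>j\<in>J. w j \<in> A j}"
    by (auto simp: prod_emb_def PiE_iff)
  have emb_sets: "{w. \<forall>j\<in>J. w j \<in> A j} \<in> sets nat_seqs"
    unfolding emb[symmetric] using J by (intro sets_PiM_I) auto
  have "emeasure (distr M nat_seqs (\<lambda>\<omega> k. X k \<omega>)) {w. \<forall>j\<in>J. w j \<in> A j}
      = emeasure M {\<omega>\<in>space M. \<forall>j\<in>J. X j \<omega> \<in> A j}"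
    using emb_sets by (subst emeasure_distr) (auto intro!: arg_cong2[where f=emeasure])
  also have "\<dots> = ennreal (\<Prod>j\<in>J. M.prob {\<omega>\<in>space M. X j \<omega> \<in> A j})"
    by (simp add: M.emeasure_eq_measure M.indep_prob_inter[OF X[OF J] J])
  also have "(\<Prod>j\<in>J. M.prob {\<omega>\<in>space M. X j \<omega> \<in> A j}) =
      (\<Prod>j\<in>J\<inter>I. M.prob {\<omega>\<in>space M. X j \<omega> \<in> A j}) * (\<Prod>j\<in>J-I. N.prob {\<omega>\<in>space N. U j \<omega> \<in> A j})"
  proof -
    have "(\<Prod>j\<in>J. M.prob {\<omega>\<in>space M. X j \<omega> \<in> A j}) =
      (\<Prod>j\<in>J\<inter>I. M.prob {\<omega>\<in>space M. X j \<omega> \<in> A j}) * (\<Prod>j\<in>J-I. M.prob {\<omega>\<in>space M. X j \<omega> \<in> A j})"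
      by (rule prod.Int_Diff[OF J])
    then show ?thesis using eq by simp
  qed
  also have "ennreal \<dots> = emeasure M {\<omega>\<in>space M. \<forall>j\<in>J\<inter>I. X j \<omega> \<in> A j} *
      emeasure N {\<omega>\<in>space N. \<forall>j\<in>J-I. U j \<omega> \<in> A j}"
    using J by (simp add: M.emeasure_eq_measure N.emeasure_eq_measure M.indep_prob_inter[OF X]
        N.indep_prob_inter[OF U] ennreal_mult prod_nonneg)
  also have "\<dots> = emeasure (M \<Otimes>\<^sub>M N)
      ({\<omega>\<in>space M. \<forall>j\<in>J\<inter>I. X j \<omega> \<in> A j} \<times> {\<omega>\<in>space N. \<forall>j\<in>J-I. U j \<omega> \<in> A j})"
  proof (rule N.emeasure_pair_measure_Times[symmetric])
    show "{\<omega>\<in>space M. \<forall>j\<in>J\<inter>I. X j \<omega> \<in> A j} \<in> sets M"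
      using J by (intro sets.sets_Collect_finite_All measurable_sets_Collect[OF mX]) auto
    show "{\<omega>\<in>space N. \<forall>j\<in>J-I. U j \<omega> \<in> A j} \<in> sets N"
      using J by (intro sets.sets_Collect_finite_All measurable_sets_Collect[OF mU]) auto
  qed
  also have "{\<omega>\<in>space M. \<forall>j\<in>J\<inter>I. X j \<omega> \<in> A j} \<times> {\<omega>\<in>space N. \<forall>j\<in>J-I. U j \<omega> \<in> A j} =
     (\<lambda>(\<omega>, \<omega>') k. if k \<in> I then X k \<omega> else U k \<omega>') -` {w. \<forall>j\<in>J. w j \<in> A j} \<inter> space (M \<Otimes>\<^sub>M N)"
    by (auto simp: space_pair_measure split: if_splits)
  also have "emeasure (M \<Otimes>\<^sub>M N) \<dots> =
     emeasure (distr (M \<Otimes>\<^sub>M N) nat_seqs (\<lambda>(\<omega>, \<omega>') k. if k \<in> I then X k \<omega> else U k \<omega>')) {w. \<forall>j\<in>J. w j \<in> A j}"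
    using emb_sets by (subst emeasure_distr) auto
  finally show "emeasure (distr M nat_seqs (\<lambda>\<omega> k. X k \<omega>)) (prod_emb UNIV (\<lambda>_. count_space UNIV) J (Pi\<^sub>E J A)) =
     emeasure (distr (M \<Otimes>\<^sub>M N) nat_seqs (\<lambda>(\<omega>, \<omega>') k. if k \<in> I then X k \<omega> else U k \<omega>'))
        (prod_emb UNIV (\<lambda>_. count_space UNIV) J (Pi\<^sub>E J A))"
    unfolding emb .
qed

text \<open>A variable with values in \<open>{0, 1}\<close> is determined in law by the probability of \<open>0\<close>; this is what makes
  the truncations of \<open>X\<^sub>k\<close> and of the cell counts equal in law.\<close>

lemma (in prob_space) prob_min_one:
  fixes Z :: "'a \<Rightarrow> nat"
  assumes [measurable]: "Z \<in> M \<rightarrow>\<^sub>M count_space UNIV"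
  shows "prob {\<omega>\<in>space M. min 1 (Z \<omega>) \<in> A} =
    (if 0 \<in> A then prob {\<omega>\<in>space M. Z \<omega> = 0} else 0) + (if 1 \<in> A then 1 - prob {\<omega>\<in>space M. Z \<omega> = 0} else 0)"
proof -
  have zero: "{\<omega>\<in>space M. Z \<omega> = 0} \<in> events" by measurable
  have compl: "prob {\<omega>\<in>space M. Z \<omega> \<noteq> 0} = 1 - prob {\<omega>\<in>space M. Z \<omega> = 0}"
    using prob_compl[OF zero] by (simp add: set_diff_eq Collect_conj_eq[symmetric])
       (metis (mono_tags, lifting) Collect_cong)
  have "min 1 (Z \<omega>) \<in> A \<longleftrightarrow> (if Z \<omega> = 0 then 0 \<in> A else 1 \<in> A)" for \<omega> by (auto simp: min_def)
  then have eq: "{\<omega>\<in>space M. min 1 (Z \<omega>) \<in> A} =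
      {\<omega>\<in>space M. (Z \<omega> = 0 \<and> 0 \<in> A) \<or> (Z \<omega> \<noteq> 0 \<and> 1 \<in> A)}"
    by (intro Collect_cong) auto
  have "{\<omega>\<in>space M. Z \<omega> = 0 \<or> Z \<omega> \<noteq> 0} = space M" by auto
  then show ?thesis
    unfolding eq using compl prob_space by (cases "0 \<in> A"; cases "1 \<in> A") simp_all
qed

lemma (in prob_space) prob_exists_ge_two_le:
  fixes W :: "nat \<Rightarrow> 'a \<Rightarrow> nat"
  assumes [measurable]: "\<And>k. W k \<in> M \<rightarrow>\<^sub>M count_space UNIV"
    and W: "\<And>k. prob {\<omega>\<in>space M. 2 \<le> W k \<omega>} \<le> s k" and s: "summable s"
  shows "prob {\<omega>\<in>space M. \<exists>k\<ge>K. 2 \<le> W k \<omega>} \<le> (\<Sum>k. s (k + K))"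
proof -
  have sK: "summable (\<lambda>k. s (k + K))" using s by (rule summable_ignore_initial_segment)
  have sQ: "summable (\<lambda>k. prob {\<omega>\<in>space M. 2 \<le> W (k + K) \<omega>})"
    by (rule summable_comparison_test'[OF sK, of 0]) (use W in auto)
  have "{\<omega>\<in>space M. \<exists>k\<ge>K. 2 \<le> W k \<omega>} = (\<Union>k. {\<omega>\<in>space M. 2 \<le> W (k + K) \<omega>})"
  proof (intro equalityI subsetI)
    fix \<omega> assume "\<omega> \<in> {\<omega>\<in>space M. \<exists>k\<ge>K. 2 \<le> W k \<omega>}"
    then obtain k where "\<omega> \<in> space M" "k \<ge> K" "2 \<le> W k \<omega>" by auto
    then have "\<omega> \<in> {\<omega>\<in>space M. 2 \<le> W ((k - K) + K) \<omega>}" by simp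
    then show "\<omega> \<in> (\<Union>k. {\<omega>\<in>space M. 2 \<le> W (k + K) \<omega>})" by blast
  qed (auto intro: le_add2)
  also have "prob \<dots> \<le> (\<Sum>k. prob {\<omega>\<in>space M. 2 \<le> W (k + K) \<omega>})"
    by (intro finite_measure_subadditive_countably sQ) auto
  also have "\<dots> \<le> (\<Sum>k. s (k + K))" by (intro suminf_le sQ sK W)
  finally show ?thesis .
qed

text \<open>Transfer of an almost sure limit on \<open>N\<close> to a limit of expectations on \<open>M\<close>. Fix \<open>K\<close> and replace \<open>X\<^sub>k\<close> by
  \<open>min 1 X\<^sub>k\<close> for \<open>k \<ge> K\<close>; then replace these in law by \<open>min 1 Y\<^sub>k\<close> on the product space, and finally by
  \<open>Y\<^sub>k\<close>. Each truncation changes the sequence with probability at most the tail \<open>\<Sum>\<^sub>k\<^sub>\<ge>\<^sub>K s\<^sub>k\<close>. For the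
  mixed sequence the first \<open>K\<close> entries may be frozen, and dominated convergence applies. The error does
  not depend on \<open>n\<close>, so one lets \<open>n\<close> tend to infinity first and \<open>K\<close> afterwards.\<close>

lemma coupling_limit:
  fixes X :: "nat \<Rightarrow> 'a \<Rightarrow> nat" and Y :: "nat \<Rightarrow> nat \<Rightarrow> 'b \<Rightarrow> nat"
    and G :: "nat \<Rightarrow> (nat \<Rightarrow> nat) \<Rightarrow> real"
  assumes M: "prob_space M" and N: "prob_space N"
    and mX[measurable]: "\<And>k. X k \<in> M \<rightarrow>\<^sub>M count_space UNIV"
    and mY[measurable]: "\<And>n k. Y n k \<in> N \<rightarrow>\<^sub>M count_space UNIV"
    and X: "\<And>J. finite J \<Longrightarrow> prob_space.indep_vars M (\<lambda>_. count_space UNIV) X J"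
    and Y: "\<And>n J. finite J \<Longrightarrow> prob_space.indep_vars N (\<lambda>_. count_space UNIV) (Y n) J"
    and zero: "\<And>n k. measure M {\<omega>\<in>space M. X k \<omega> = 0} = measure N {\<omega>\<in>space N. Y n k \<omega> = 0}"
    and two: "\<And>k. measure M {\<omega>\<in>space M. 2 \<le> X k \<omega>} \<le> s k"
      "\<And>n k. measure N {\<omega>\<in>space N. 2 \<le> Y n k \<omega>} \<le> s k"
    and s: "summable s"
    and G[measurable]: "\<And>n. G n \<in> borel_measurable nat_seqs" and B: "\<And>n w. \<bar>G n w\<bar> \<le> B"
    and Z[measurable]: "\<zeta> \<in> borel_measurable N"
    and lim: "\<And>K x. AE \<omega> in N. (\<lambda>n. G n (\<lambda>k. if k < K then x k else Y n k \<omega>)) \<longlonglongrightarrow> \<zeta> \<omega>"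
  shows "(\<lambda>n. LINT \<omega>|M. G n (\<lambda>k. X k \<omega>)) \<longlonglongrightarrow> (LINT \<omega>|N. \<zeta> \<omega>)"
proof -
  interpret M: prob_space M by fact
  interpret N: prob_space N by fact
  interpret MN: pair_prob_space M N ..
  have B0: "B \<ge> 0" using B[of 0 undefined] by linarith
  define tail where "tail K = (\<Sum>k. s (k + K))" for K
  have bound: "\<bar>(LINT \<omega>|M. G n (\<lambda>k. X k \<omega>)) -
      (LINT \<omega>|(M \<Otimes>\<^sub>M N). G n (\<lambda>k. if k < K then X k (fst \<omega>) else Y n k (snd \<omega>)))\<bar> \<le> 4 * B * tail K" for n K
  proof -
    let ?X' = "\<lambda>\<omega> k. if k < K then X k \<omega> else min 1 (X k \<omega>)"
    let ?Z' = "\<lambda>(\<omega>, \<omega>') k. if k < K then X k \<omega> else min 1 (Y n k \<omega>')"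
    let ?Z = "\<lambda>(\<omega>, \<omega>') k. if k < K then X k \<omega> else Y n k \<omega>'"
    have mX0[measurable]: "(\<lambda>\<omega> k. X k \<omega>) \<in> M \<rightarrow>\<^sub>M nat_seqs"
      by (rule measurable_PiM_single') auto
    have mX'[measurable]: "?X' \<in> M \<rightarrow>\<^sub>M nat_seqs"
      by (rule measurable_PiM_single') auto
    have mZ[measurable]: "?Z \<in> M \<Otimes>\<^sub>M N \<rightarrow>\<^sub>M nat_seqs"
      by (rule measurable_PiM_single') (auto simp: case_prod_beta)
    have mZ'[measurable]: "?Z' \<in> M \<Otimes>\<^sub>M N \<rightarrow>\<^sub>M nat_seqs"
      by (rule measurable_PiM_single') (auto simp: case_prod_beta)
    have 1: "\<bar>(LINT \<omega>|M. G n (\<lambda>k. X k \<omega>)) - (LINT \<omega>|M. G n (?X' \<omega>))\<bar> \<le> 2 * B * tail K"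
    proof -
      have "\<bar>(LINT \<omega>|M. G n (\<lambda>k. X k \<omega>)) - (LINT \<omega>|M. G n (?X' \<omega>))\<bar>
          \<le> 2 * B * M.prob {\<omega>\<in>space M. \<exists>k\<ge>K. 2 \<le> X k \<omega>}"
      proof (rule abs_integral_diff_le[OF M])
        fix \<omega> assume "\<omega> \<in> space M" "\<omega> \<notin> {\<omega>\<in>space M. \<exists>k\<ge>K. 2 \<le> X k \<omega>}"
        then have "X k \<omega> < 2" if "k \<ge> K" for k using that not_le by blast
        then have "min 1 (X k \<omega>) = X k \<omega>" if "k \<ge> K" for k using that by fastforce
        then have "(\<lambda>k. X k \<omega>) = ?X' \<omega>" by (simp add: fun_eq_iff not_less)
        then show "G n (\<lambda>k. X k \<omega>) = G n (?X' \<omega>)" by simp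
      qed (use B in measurable)
      also have "\<dots> \<le> 2 * B * tail K"
        unfolding tail_def using B0 by (intro mult_left_mono M.prob_exists_ge_two_le two s) auto
      finally show ?thesis .
    qed
    have 2: "distr M nat_seqs ?X' = distr (M \<Otimes>\<^sub>M N) nat_seqs ?Z'"
    proof -
      have "distr M nat_seqs (\<lambda>\<omega> k. ?X' \<omega> k) = distr (M \<Otimes>\<^sub>M N) nat_seqs
          (\<lambda>(\<omega>, \<omega>') k. if k \<in> {..<K} then ?X' \<omega> k else min 1 (Y n k \<omega>'))"
      proof (rule distr_independent_splice[OF M N])
        fix J :: "nat set" assume J: "finite J"
        have "M.indep_vars (\<lambda>_. count_space UNIV) (\<lambda>k \<omega>. (\<lambda>x. if k < K then x else min 1 x) (X k \<omega>)) J"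
          by (rule M.indep_vars_compose2[OF X[OF J]]) auto
        then show "M.indep_vars (\<lambda>_. count_space UNIV) (\<lambda>k \<omega>. ?X' \<omega> k) J" by simp
        show "N.indep_vars (\<lambda>_. count_space UNIV) (\<lambda>k \<omega>. min 1 (Y n k \<omega>)) J"
          by (rule N.indep_vars_compose2[OF Y[OF J]]) auto
      next
        fix k and A :: "nat set" assume "k \<notin> {..<K}"
        then show "M.prob {\<omega> \<in> space M. ?X' \<omega> k \<in> A} = N.prob {\<omega> \<in> space N. min 1 (Y n k \<omega>) \<in> A}"
          using M.prob_min_one[OF mX[of k], of A] N.prob_min_one[OF mY[of n k], of A] zero[of k n] by simp
      qed auto
      also have "(\<lambda>(\<omega>, \<omega>') k. if k \<in> {..<K} then ?X' \<omega> k else min 1 (Y n k \<omega>')) = ?Z'"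
        by (auto simp: fun_eq_iff)
      finally show ?thesis .
    qed
    have 3: "(LINT \<omega>|M. G n (?X' \<omega>)) = (LINT \<omega>|(M \<Otimes>\<^sub>M N). G n (?Z' \<omega>))"
      using integral_distr[OF mX' G] integral_distr[OF mZ' G] unfolding 2 by simp
    have 4: "\<bar>(LINT \<omega>|(M \<Otimes>\<^sub>M N). G n (?Z' \<omega>)) - (LINT \<omega>|(M \<Otimes>\<^sub>M N). G n (?Z \<omega>))\<bar> \<le> 2 * B * tail K"
    proof -
      let ?E = "{\<omega>\<in>space N. \<exists>k\<ge>K. 2 \<le> Y n k \<omega>}"
      have E: "?E \<in> sets N" by measurable
      have "\<bar>(LINT \<omega>|(M \<Otimes>\<^sub>M N). G n (?Z' \<omega>)) - (LINT \<omega>|(M \<Otimes>\<^sub>M N). G n (?Z \<omega>))\<bar>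
          \<le> 2 * B * MN.prob (space M \<times> ?E)"
      proof (rule abs_integral_diff_le[OF MN.prob_space_axioms])
        show "space M \<times> ?E \<in> sets (M \<Otimes>\<^sub>M N)" using E by auto
        fix \<omega> assume w: "\<omega> \<in> space (M \<Otimes>\<^sub>M N)" "\<omega> \<notin> space M \<times> ?E"
        then have "Y n k (snd \<omega>) < 2" if "k \<ge> K" for k
          using that not_le by (auto simp: space_pair_measure)
        then have "min 1 (Y n k (snd \<omega>)) = Y n k (snd \<omega>)" if "k \<ge> K" for k using that by fastforce
        then have "?Z' \<omega> = ?Z \<omega>" by (simp add: fun_eq_iff not_less case_prod_beta)
        then show "G n (?Z' \<omega>) = G n (?Z \<omega>)" by simp
      qed (use B in measurable)
      also have "MN.prob (space M \<times> ?E) = N.prob ?E"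
        using N.emeasure_pair_measure_Times[OF sets.top E, of M] M.emeasure_space_1
        by (simp add: measure_def)
      also have "2 * B * N.prob ?E \<le> 2 * B * tail K"
        unfolding tail_def using B0 by (intro mult_left_mono N.prob_exists_ge_two_le two s) auto
      finally show ?thesis .
    qed
    have "?Z = (\<lambda>\<omega> k. if k < K then X k (fst \<omega>) else Y n k (snd \<omega>))"
      by (auto simp: fun_eq_iff)
    then show ?thesis using 1 3 4 by (simp add: abs_le_iff)
  qed
  have limK: "(\<lambda>n. LINT \<omega>|(M \<Otimes>\<^sub>M N). G n (\<lambda>k. if k < K then X k (fst \<omega>) else Y n k (snd \<omega>)))
      \<longlonglongrightarrow> (LINT \<omega>|N. \<zeta> \<omega>)" for K
  proof -
    let ?Z = "\<lambda>n \<omega>. \<lambda>k. if k < K then X k (fst \<omega>) else Y n k (snd \<omega>)"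
    have mZ[measurable]: "?Z n \<in> M \<Otimes>\<^sub>M N \<rightarrow>\<^sub>M nat_seqs" for n
      by (rule measurable_PiM_single') auto
    have GZ: "(\<lambda>\<omega>. G n (?Z n \<omega>)) \<in> borel_measurable (M \<Otimes>\<^sub>M N)" for n by measurable
    have "integrable (M \<Otimes>\<^sub>M N) (\<lambda>\<omega>. G n (?Z n \<omega>))" for n
      by (rule MN.integrable_const_bound[of _ B]) (use B GZ in auto)
    then have fub: "(LINT \<omega>|(M \<Otimes>\<^sub>M N). G n (?Z n \<omega>)) = (LINT x|M. LINT y|N. G n (?Z n (x, y)))" for n
      by (rule MN.integral_fst'[symmetric])
    have "(\<lambda>n. LINT x|M. LINT y|N. G n (?Z n (x, y))) \<longlonglongrightarrow> (LINT x|M. LINT y|N. \<zeta> y)"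
    proof (rule integral_dominated_convergence[where w = "\<lambda>_. B"])
      show "(\<lambda>x. LINT y|N. G n (?Z n (x, y))) \<in> borel_measurable M" for n
        using GZ[of n] by (intro N.borel_measurable_lebesgue_integral) (simp add: case_prod_beta)
      have pt: "(\<lambda>n. LINT y|N. G n (?Z n (x, y))) \<longlonglongrightarrow> (LINT y|N. \<zeta> y)" if "x \<in> space M" for x
      proof (rule integral_dominated_convergence[where w = "\<lambda>_. B"])
        show "(\<lambda>y. G n (?Z n (x, y))) \<in> borel_measurable N" for n
          using measurable_Pair2[OF GZ that] by simp
        show "AE y in N. (\<lambda>n. G n (?Z n (x, y))) \<longlonglongrightarrow> \<zeta> y"
          using lim[of K "\<lambda>k. X k x"] by (simp only: fst_conv snd_conv)
      qed (use B in auto)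
      show "AE x in M. (\<lambda>n. LINT y|N. G n (?Z n (x, y))) \<longlonglongrightarrow> (LINT y|N. \<zeta> y)"
        using pt by (rule AE_I2)
      show "AE x in M. norm (LINT y|N. G n (?Z n (x, y))) \<le> B" for n
      proof (rule AE_I2)
        fix x assume "x \<in> space M"
        have int: "integrable N (\<lambda>y. G n (?Z n (x, y)))"
          by (rule N.integrable_const_bound[of _ B])
            (use B measurable_Pair2[OF GZ \<open>x \<in> space M\<close>] in auto)
        have "norm (LINT y|N. G n (?Z n (x, y))) \<le> (LINT y|N. norm (G n (?Z n (x, y))))"
          by (rule integral_norm_bound)
        also have "\<dots> \<le> (LINT y|N. B)"
          using integrable_norm[OF int] by (rule integral_mono) (use B in auto)
        finally have "norm (LINT y|N. G n (?Z n (x, y))) \<le> (LINT y|N. B)" .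
        then show "norm (LINT y|N. G n (?Z n (x, y))) \<le> B" by (simp add: N.prob_space)
      qed
    qed auto
    then show ?thesis unfolding fub by (simp add: M.prob_space)
  qed
  show ?thesis
  proof (rule LIMSEQ_I)
    fix e :: real assume e: "e > 0"
    \<comment> \<open>the added \<open>1\<close> covers the case \<open>B = 0\<close>\<close>
    obtain K where K: "\<bar>tail K\<bar> < e / (2 * (4 * B + 1))"
      using suminf_exist_split[OF _ s, of "e / (2 * (4 * B + 1))"] e B0 unfolding tail_def by auto
    have "4 * B * tail K \<le> 4 * B * \<bar>tail K\<bar>" using B0 by (intro mult_left_mono) auto
    also have "\<dots> \<le> (4 * B + 1) * \<bar>tail K\<bar>" by (simp add: algebra_simps)
    also have "\<dots> < e / 2" using K B0 by (simp add: field_simps)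
    finally have small: "4 * B * tail K < e / 2" .
    obtain n0 where n0: "\<And>n. n \<ge> n0 \<Longrightarrow>
       norm ((LINT \<omega>|(M \<Otimes>\<^sub>M N). G n (\<lambda>k. if k < K then X k (fst \<omega>) else Y n k (snd \<omega>))) - (LINT \<omega>|N. \<zeta> \<omega>)) < e / 2"
      using LIMSEQ_D[OF limK[of K], of "e / 2"] e by auto
    show "\<exists>n0. \<forall>n\<ge>n0. norm ((LINT \<omega>|M. G n (\<lambda>k. X k \<omega>)) - (LINT \<omega>|N. \<zeta> \<omega>)) < e"
    proof (intro exI allI impI)
      fix n assume "n \<ge> n0"
      from n0[OF this] bound[of n K] small
      show "norm ((LINT \<omega>|M. G n (\<lambda>k. X k \<omega>)) - (LINT \<omega>|N. \<zeta> \<omega>)) < e"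
        unfolding real_norm_def by linarith
    qed
  qed
qed

lemma (in prob_space) prob_ge_two:
  fixes Z :: "'a \<Rightarrow> nat"
  assumes [measurable]: "Z \<in> M \<rightarrow>\<^sub>M count_space UNIV"
  shows "prob {\<omega>\<in>space M. 2 \<le> Z \<omega>} = 1 - prob {\<omega>\<in>space M. Z \<omega> = 0} - prob {\<omega>\<in>space M. Z \<omega> = 1}"
proof -
  let ?A = "\<lambda>m. {\<omega>\<in>space M. Z \<omega> = m}"
  have "prob (?A 0 \<union> ?A 1) = prob (?A 0) + prob (?A 1)"
    by (rule finite_measure_Union) auto
  moreover have "prob (space M - (?A 0 \<union> ?A 1)) = 1 - prob (?A 0 \<union> ?A 1)"
    by (rule prob_compl) auto
  moreover have "space M - (?A 0 \<union> ?A 1) = {\<omega>\<in>space M. 2 \<le> Z \<omega>}" by auto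
  ultimately show ?thesis by simp
qed

section \<open>Vague topology and prime processes\<close>

lemma limitin_topology_generated_by:
  assumes l: "l \<in> \<Union>S" and lim: "\<And>U. U \<in> S \<Longrightarrow> l \<in> U \<Longrightarrow> eventually (\<lambda>n. f n \<in> U) F"
  shows "limitin (topology_generated_by S) f l F"
  unfolding limitin_def
proof (intro conjI allI impI)
  show "l \<in> topspace (topology_generated_by S)" using l by simp
  fix U assume "openin (topology_generated_by S) U \<and> l \<in> U"
  then have "generate_topology_on S U" and "l \<in> U" by (auto dest: openin_topology_generated_by)
  then show "eventually (\<lambda>n. f n \<in> U) F"
  proof (induction rule: generate_topology_on.induct)
    case (Int a b)
    then show ?case by (auto intro: eventually_conj)
  next
    case (UN K)
    then obtain k where "k \<in> K" "l \<in> k" by auto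
    then have "eventually (\<lambda>n. f n \<in> k) F" using UN by auto
    then show ?case by eventually_elim (use \<open>k \<in> K\<close> in auto)
  qed (use lim in auto)
qed

lemma limitin_vague_topology:
  assumes "\<mu> \<in> locally_finite_measures" "\<And>n. \<mu>s n \<in> locally_finite_measures"
    and "\<And>f. vague_test_function f \<Longrightarrow> (\<lambda>n. LINT x|\<mu>s n. f x) \<longlonglongrightarrow> (LINT x|\<mu>. f x)"
  shows "limitin vague_topology \<mu>s \<mu> sequentially"
  unfolding vague_topology_def
proof (rule limitin_topology_generated_by)
  show "\<mu> \<in> \<Union> {{\<mu> \<in> locally_finite_measures. (LINT x|\<mu>. f x) \<in> U} | f U. vague_test_function f \<and> open U}"
    using assms(1) topspace_vague_topology unfolding vague_topology_def by auto
  fix V assume "V \<in> {{\<mu> \<in> locally_finite_measures. (LINT x|\<mu>. f x) \<in> U} | f U. vague_test_function f \<and> open U}" "\<mu> \<in> V"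
  then obtain f U where V: "V = {\<mu> \<in> locally_finite_measures. (LINT x|\<mu>. f x) \<in> U}"
    and f: "vague_test_function f" and U: "open U" "(LINT x|\<mu>. f x) \<in> U" by auto
  have "eventually (\<lambda>n. (LINT x|\<mu>s n. f x) \<in> U) sequentially"
    using topological_tendstoD[OF assms(3)[OF f] U] .
  then show "eventually (\<lambda>n. \<mu>s n \<in> V) sequentially"
    by eventually_elim (use assms(2) V in auto)
qed

lemma space_topology_borel: "space (topology_borel T) = topspace T"
  unfolding topology_borel_def by (rule space_measure_of) (auto dest: openin_subset)

lemma measurable_topology_borelI:
  assumes "f \<in> space M \<rightarrow> topspace T" "\<And>U. openin T U \<Longrightarrow> f -` U \<inter> space M \<in> sets M"
  shows "f \<in> M \<rightarrow>\<^sub>M topology_borel T"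
  unfolding topology_borel_def
  by (rule measurable_measure_of) (use assms in \<open>auto dest: openin_subset\<close>)

lemma continuous_map_measurable_topology_borel:
  fixes F :: "'s \<Rightarrow> real"
  assumes "continuous_map T euclideanreal F"
  shows "F \<in> borel_measurable (topology_borel T)"
proof (rule borel_measurableI)
  fix S :: "real set" assume "open S"
  then have "openin T {x \<in> topspace T. F x \<in> S}"
    using assms by (auto intro: openin_continuous_map_preimage)
  moreover have "F -` S \<inter> space (topology_borel T) = {x \<in> topspace T. F x \<in> S}"
    by (auto simp: space_topology_borel)
  ultimately show "F -` S \<inter> space (topology_borel T) \<in> sets (topology_borel T)"
    unfolding topology_borel_def by (auto simp: sets_measure_of_conv dest: openin_subset)
qed

lemma compact_pos_subset_Icc:
  fixes K :: "real set"
  assumes "compact K" "K \<subseteq> {0<..}"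
  obtains a b where "0 < a" "a \<le> b" "K \<subseteq> {a..b}"
proof (cases "K = {}")
  case True
  then show ?thesis by (intro that[of 1 1]) auto
next
  case False
  obtain a where a: "a \<in> K" "\<And>t. t \<in> K \<Longrightarrow> a \<le> t"
    using compact_attains_inf[OF assms(1) False] by auto
  obtain b where b: "b \<in> K" "\<And>t. t \<in> K \<Longrightarrow> t \<le> b"
    using compact_attains_sup[OF assms(1) False] by auto
  show ?thesis using a b assms(2) by (intro that[of a b]) auto
qed

text \<open>A test function vanishes near \<open>0\<close>, so it is bounded by a multiple of the identity. In this form it falls
  under the pathwise limit together with the identity on \<open>(0, 1]\<close>.\<close>

lemma vague_test_functionE:
  assumes "vague_test_function f"
  obtains A b where "0 < b" "\<And>t. b < t \<Longrightarrow> f t = 0" "\<And>t. 0 < t \<Longrightarrow> \<bar>f t\<bar> \<le> A * t"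
    "\<And>t. 0 < t \<Longrightarrow> isCont f t" "f \<in> borel_measurable pos_borel"
proof -
  obtain K where K: "compact K" "K \<subseteq> {0<..}" "\<And>x. 0 < x \<Longrightarrow> x \<notin> K \<Longrightarrow> f x = 0"
    and cont: "continuous_on {0<..} f"
    using assms unfolding vague_test_function_def by fastforce
  obtain a b where ab: "0 < a" "a \<le> b" "K \<subseteq> {a..b}" using compact_pos_subset_Icc[OF K(1,2)] .
  have "continuous_on {a..b} f" by (rule continuous_on_subset[OF cont]) (use ab(1) in auto)
  then have "bounded (f ` {a..b})" by (intro compact_imp_bounded compact_continuous_image) auto
  then obtain B where B: "\<And>t. t \<in> {a..b} \<Longrightarrow> \<bar>f t\<bar> \<le> B"
    unfolding bounded_iff real_norm_def by blast
  have B0: "B \<ge> 0" using B[of a] ab by auto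
  show ?thesis
  proof (rule that[of b "B / a"])
    show "0 < b" using ab by simp
    show "f t = 0" if "b < t" for t using that ab K(3)[of t] by force
    show "isCont f t" if "0 < t" for t
      using cont that by (auto simp: continuous_on_eq_continuous_at)
    show "f \<in> borel_measurable pos_borel"
      unfolding pos_borel_def using cont by (rule borel_measurable_continuous_on_restrict)
    show "\<bar>f t\<bar> \<le> B / a * t" if "0 < t" for t
    proof (cases "t \<in> K")
      case True
      then have "a \<le> t" "\<bar>f t\<bar> \<le> B" using ab B by auto
      moreover have "B * 1 \<le> B * (t / a)" using B0 ab \<open>a \<le> t\<close> by (intro mult_left_mono) auto
      ultimately show ?thesis by simp
    next
      case False
      then show ?thesis using K(3)[OF that] B0 ab that by simp
    qed
  qed
qed

lemma sets_dirac_series: "sets (dirac_series w x) = sets pos_borel"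
  by (simp add: dirac_series_def)

lemma space_pos_borel: "space pos_borel = {0<..}"
  by (simp add: pos_borel_def space_restrict_space)

lemma integral_dirac_series:
  assumes x: "\<And>k. 0 < x k" and f: "f \<in> borel_measurable pos_borel"
    and S: "finite S" "\<And>k. k \<notin> S \<Longrightarrow> f (x k) = 0"
  shows "(LINT t|dirac_series w x. f t) = (\<Sum>k\<in>S. real (w k) * f (x k))"
proof -
  have mx: "x \<in> density (count_space UNIV) (\<lambda>k. ennreal (real (w k))) \<rightarrow>\<^sub>M pos_borel"
    using x by (auto simp: measurable_def space_pos_borel)
  have "(LINT t|dirac_series w x. f t) = (LINT k|density (count_space UNIV) (\<lambda>k. ennreal (real (w k))). f (x k))"
    unfolding dirac_series_def using integral_distr[OF mx f] by (simp add: ennreal_of_nat_eq_real_of_nat)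
  also have "\<dots> = (LINT k|count_space UNIV. real (w k) *\<^sub>R f (x k))"
    by (rule integral_density) auto
  also have "\<dots> = (\<Sum>k | k \<in> UNIV \<and> real (w k) *\<^sub>R f (x k) \<noteq> 0. real (w k) *\<^sub>R f (x k))"
  proof (rule lebesgue_integral_count_space_finite_support)
    show "finite {k \<in> UNIV. real (w k) *\<^sub>R f (x k) \<noteq> 0}"
      by (rule finite_subset[OF _ S(1)]) (use S(2) in auto)
  qed
  also have "\<dots> = (\<Sum>k\<in>S. real (w k) * f (x k))"
    by (rule sum.mono_neutral_cong_left) (use S in auto)
  finally show ?thesis .
qed

text \<open>A sum of naturals either has finitely many non-zero terms, or exceeds every natural number.\<close>

lemma counting_valued_dirac_series:
  assumes x: "\<And>k. 0 < x k"
  shows "counting_valued (dirac_series w x)"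
  unfolding counting_valued_def
proof
  fix B assume "B \<in> sets (dirac_series w x)"
  then have B: "B \<in> sets pos_borel" by (simp add: sets_dirac_series)
  define g where "g k = (if x k \<in> B then w k else 0)" for k
  have e: "emeasure (dirac_series w x) B = (\<Sum>k. of_nat (g k))"
    unfolding emeasure_dirac_series[OF x B] g_def
    by (intro arg_cong[where f = suminf]) (auto simp: fun_eq_iff)
  show "emeasure (dirac_series w x) B = \<infinity> \<or> (\<exists>k::nat. emeasure (dirac_series w x) B = of_nat k)"
  proof (cases "finite {k. g k \<noteq> 0}")
    case True
    then have "emeasure (dirac_series w x) B = (\<Sum>k | g k \<noteq> 0. of_nat (g k))"
      unfolding e by (intro suminf_finite) auto
    also have "\<dots> = of_nat (\<Sum>k | g k \<noteq> 0. g k)" by simp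
    finally show ?thesis by blast
  next
    case False
    have "emeasure (dirac_series w x) B = \<infinity>"
    proof (rule ccontr)
      assume "emeasure (dirac_series w x) B \<noteq> \<infinity>"
      then obtain n :: nat where n: "emeasure (dirac_series w x) B < of_nat n"
        using ennreal_Ex_less_of_nat by (auto simp: less_top)
      obtain F where F: "finite F" "card F = n" "F \<subseteq> {k. g k \<noteq> 0}"
        using infinite_arbitrarily_large[OF False] by blast
      have "(of_nat n :: ennreal) = (\<Sum>k\<in>F. of_nat 1)" using F by simp
      also have "\<dots> \<le> (\<Sum>k\<in>F. of_nat (g k))"
        using F by (intro sum_mono of_nat_mono) (auto simp: Suc_le_eq)
      also have "\<dots> \<le> (\<Sum>k. of_nat (g k))"
        using F by (intro sum_le_suminf summableI) auto
      finally show False using n unfolding e by simp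
    qed
    then show ?thesis ..
  qed
qed

lemma dirac_series_prime_point_locally_finite:
  "dirac_series w (prime_point n) \<in> locally_finite_measures"
  unfolding locally_finite_measures_def
proof (intro CollectI conjI allI impI)
  show "space (dirac_series w (prime_point n)) = {0<..}"
    using sets_eq_imp_space_eq[OF sets_dirac_series] by (simp add: space_pos_borel)
  show "sets (dirac_series w (prime_point n)) = sets pos_borel" by (rule sets_dirac_series)
  fix K :: "real set" assume "compact K \<and> K \<subseteq> {0<..}"
  then have K: "compact K" "K \<subseteq> {0<..}" by auto
  obtain a b where ab: "0 < a" "a \<le> b" "K \<subseteq> {a..b}" using compact_pos_subset_Icc[OF K] .
  have "K \<in> sets borel" using K by (auto intro: borel_compact)
  then have "K \<in> sets pos_borel" using K(2) unfolding pos_borel_def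
    by (auto simp: sets_restrict_space_iff)
  then have "emeasure (dirac_series w (prime_point n)) K =
      (\<Sum>k. of_nat (w k) * indicator K (prime_point n k))"
    by (intro emeasure_dirac_series prime_point_pos)
  also have "\<dots> = (\<Sum>k | prime_point n k \<le> b. of_nat (w k) * indicator K (prime_point n k))"
    using ab by (intro suminf_finite finite_prime_point_le) (auto simp: indicator_def)
  also have "\<dots> = of_nat (\<Sum>k | prime_point n k \<le> b. w k * indicator K (prime_point n k))"
    unfolding of_nat_sum by (intro sum.cong) (auto simp: indicator_def)
  also have "\<dots> < \<infinity>"
    unfolding infinity_ennreal_def by (rule of_nat_less_top)
  finally show "emeasure (dirac_series w (prime_point n)) K < \<infinity>" .
qed

lemma integral_dirac_series_prime_point:
  assumes "vague_test_function f" "\<And>t. b < t \<Longrightarrow> f t = 0"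
  shows "(LINT t|dirac_series w (prime_point n). f t) =
    (\<Sum>k | prime_point n k \<le> b. real (w k) * f (prime_point n k))"
proof (rule integral_dirac_series[OF prime_point_pos])
  show "f \<in> borel_measurable pos_borel" using vague_test_functionE[OF assms(1)] by blast
qed (use assms finite_prime_point_le in \<open>auto simp: not_le\<close>)

text \<open>The atoms tend to infinity, so a test function meets finitely many of them and its integral depends on
  finitely many weights.\<close>

lemma continuous_map_dirac_series_prime_point:
  "continuous_map euclidean vague_topology (\<lambda>w. dirac_series w (prime_point n))"
  unfolding vague_topology_def
proof (rule continuous_on_generated_topo)
  fix V assume "V \<in> {{\<mu> \<in> locally_finite_measures. (LINT x|\<mu>. f x) \<in> U} | f U. vague_test_function f \<and> open U}"
  then obtain f U where V: "V = {\<mu> \<in> locally_finite_measures. (LINT x|\<mu>. f x) \<in> U}"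
    and f: "vague_test_function f" and U: "open U" by auto
  obtain b where b: "\<And>t. b < t \<Longrightarrow> f t = 0" using vague_test_functionE[OF f] by metis
  have "(\<lambda>w. dirac_series w (prime_point n)) -` V \<inter> topspace euclidean =
      (\<lambda>w. \<Sum>k | prime_point n k \<le> b. real (w k) * f (prime_point n k)) -` U"
    unfolding V using dirac_series_prime_point_locally_finite
    by (auto simp: integral_dirac_series_prime_point[OF f b])
  moreover have "open \<dots>"
    by (intro open_vimage U continuous_on_sum continuous_on_mult continuous_on_of_nat
      continuous_on_product_coordinates continuous_on_const)
  ultimately show "openin euclidean ((\<lambda>w. dirac_series w (prime_point n)) -` V \<inter> topspace euclidean)"
    by (simp add: open_openin[symmetric])
next
  show "(\<lambda>w. dirac_series w (prime_point n)) ` topspace euclidean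
    \<subseteq> \<Union> {{\<mu> \<in> locally_finite_measures. (LINT x|\<mu>. f x) \<in> U} | f U. vague_test_function f \<and> open U}"
    using dirac_series_prime_point_locally_finite topspace_vague_topology
    unfolding vague_topology_def by auto
qed

text \<open>Passing through continuity handles arbitrary unions of vaguely open sets: preimages are open sets of
  sequences of naturals, and these lie in the product sigma-algebra because that space is second countable.\<close>

lemma measurable_dirac_series_prime_point:
  "(\<lambda>w. dirac_series w (prime_point n)) \<in> nat_seqs \<rightarrow>\<^sub>M topology_borel vague_topology"
proof (rule measurable_topology_borelI)
  show "(\<lambda>w. dirac_series w (prime_point n)) \<in> space nat_seqs \<rightarrow> topspace vague_topology"
    using dirac_series_prime_point_locally_finite by (auto simp: topspace_vague_topology)
  fix U assume "openin vague_topology U"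
  then have "openin euclidean {w \<in> topspace euclidean. dirac_series w (prime_point n) \<in> U}"
    by (rule openin_continuous_map_preimage[OF continuous_map_dirac_series_prime_point])
  then have "open {w. dirac_series w (prime_point n) \<in> U}" by (simp add: open_openin[symmetric])
  then have "{w. dirac_series w (prime_point n) \<in> U} \<in> sets (borel :: (nat \<Rightarrow> nat) measure)" by simp
  also have "sets (borel :: (nat \<Rightarrow> nat) measure) = sets nat_seqs"
    unfolding sets_PiM_equal_borel[symmetric] by (intro sets_PiM_cong refl) (simp add: sets_borel_eq_count_space)
  finally show "(\<lambda>w. dirac_series w (prime_point n)) -` U \<inter> space nat_seqs \<in> sets nat_seqs"
    by (simp add: vimage_def space_PiM)
qed

lemma prime_process_eq: "prime_process X n \<omega> = dirac_series (\<lambda>k. X k \<omega>) (prime_point n)"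
  unfolding prime_process_def prime_point_def[abs_def] ..

lemma point_process_prime_process:
  assumes M: "prob_space M" and X: "\<And>k. X k \<in> M \<rightarrow>\<^sub>M count_space UNIV"
  shows "point_process M (prime_process X n)"
proof -
  have "(\<lambda>\<omega> k. X k \<omega>) \<in> M \<rightarrow>\<^sub>M nat_seqs" by (rule measurable_PiM_single') (use X in auto)
  from measurable_compose[OF this measurable_dirac_series_prime_point]
  show ?thesis
    unfolding point_process_def prime_process_eq[abs_def]
    using M counting_valued_dirac_series prime_point_pos by auto
qed

section \<open>The Poisson process with intensity \<open>dt / t\<close>\<close>

lemma emeasure_inverse_intensity:
  assumes ab: "0 < a" "a \<le> b"
  shows "emeasure inverse_intensity {a<..b} = ennreal (ln (b / a))"
proof -
  have m: "(\<lambda>t. ennreal (1 / t)) \<in> borel_measurable (restrict_space lborel {0<..})"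
    by (intro measurable_restrict_space1) measurable
  have S: "{a<..b} \<in> sets (restrict_space lborel {0<..})"
    using ab by (auto simp: sets_restrict_space_iff)
  have "emeasure inverse_intensity {a<..b} =
      (\<integral>\<^sup>+t. ennreal (1 / t) * indicator {a<..b} t \<partial>restrict_space lborel {0<..})"
    unfolding inverse_intensity_def by (rule emeasure_density[OF m S])
  also have "\<dots> = (\<integral>\<^sup>+t. ennreal (1 / t) * indicator {a<..b} t * indicator {0<..} t \<partial>lborel)"
    by (rule nn_integral_restrict_space) auto
  also have "\<dots> = (\<integral>\<^sup>+t. ennreal (1 / t) * indicator {a..b} t \<partial>lborel)"
    using AE_lborel_singleton[of a] ab
    by (intro nn_integral_cong_AE) (auto elim!: eventually_mono simp: indicator_def)
  also have "\<dots> = ennreal (ln b - ln a)"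
    using ab by (intro nn_integral_FTC_Icc) (auto intro!: derivative_eq_intros simp: divide_inverse)
  finally show ?thesis using ab by (simp add: ln_div)
qed

lemma measure_inverse_intensity:
  "0 < a \<Longrightarrow> a \<le> b \<Longrightarrow> measure inverse_intensity {a<..b} = ln (b / a)"
  by (simp add: measure_def emeasure_inverse_intensity)

lemma poisson_mean_sums: "(\<lambda>m. real m * (l ^ m / fact m * exp (- l))) sums l" for l :: real
proof -
  have "(\<lambda>m. l ^ m /\<^sub>R fact m * (l * exp (- l))) sums (exp l * (l * exp (- l)))"
    by (intro sums_mult2 exp_converges)
  also have "exp l * (l * exp (- l)) = l" by (simp add: exp_minus)
  also have "(\<lambda>m. l ^ m /\<^sub>R fact m * (l * exp (- l))) =
      (\<lambda>m. real (Suc m) * (l ^ Suc m / fact (Suc m) * exp (- l)))"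
  proof
    fix m
    have "(1 + real m) * (l ^ Suc m / ((1 + real m) * fact m)) = l ^ Suc m / fact m" by simp
    then show "l ^ m /\<^sub>R fact m * (l * exp (- l)) = real (Suc m) * (l ^ Suc m / fact (Suc m) * exp (- l))"
      by (simp add: divide_inverse mult_ac)
  qed
  finally show ?thesis by (subst (asm) sums_Suc_iff) simp
qed

text \<open>The default value \<open>0\<close> for sets of infinite mass and the rounding are harmless: the function is evaluated
  on cells, whose mass is a natural number.\<close>

definition points_in :: "('b \<Rightarrow> real measure) \<Rightarrow> real set \<Rightarrow> 'b \<Rightarrow> nat" where
  "points_in \<eta> B \<omega> = nat \<lfloor>measure (\<eta> \<omega>) B\<rfloor>"

locale inverse_poisson =
  fixes N :: "'b measure" and \<eta> :: "'b \<Rightarrow> real measure"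
  assumes pois: "poisson_process inverse_intensity N \<eta>"
begin

sublocale prob_space N
  using pois unfolding poisson_process_def point_process_def by simp

lemma eta_locally_finite: "\<omega> \<in> space N \<Longrightarrow> \<eta> \<omega> \<in> locally_finite_measures"
proof -
  have "\<eta> \<in> N \<rightarrow>\<^sub>M topology_borel vague_topology"
    using pois unfolding poisson_process_def point_process_def by simp
  then show "\<omega> \<in> space N \<Longrightarrow> \<eta> \<omega> \<in> locally_finite_measures"
    by (auto dest: measurable_space simp: space_topology_borel topspace_vague_topology)
qed

lemma space_eta: "\<omega> \<in> space N \<Longrightarrow> space (\<eta> \<omega>) = {0<..}"
  and sets_eta: "\<omega> \<in> space N \<Longrightarrow> sets (\<eta> \<omega>) = sets pos_borel"
  and finite_eta: "\<omega> \<in> space N \<Longrightarrow> 0 < a \<Longrightarrow> emeasure (\<eta> \<omega>) {a..b} < \<infinity>"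
  using eta_locally_finite[of \<omega>] unfolding locally_finite_measures_def
  by (auto dest!: spec[of _ "{a..b}"])

lemma indep_emeasure:
  assumes "finite I" "\<And>i. i \<in> I \<Longrightarrow> B i \<in> sets pos_borel" "disjoint_family_on B I"
  shows "indep_vars (\<lambda>_. borel) (\<lambda>i \<omega>. emeasure (\<eta> \<omega>) (B i)) (I :: nat set)"
  using pois assms unfolding poisson_process_def by blast

lemma prob_emeasure:
  assumes "B \<in> sets pos_borel" "emeasure inverse_intensity B < \<infinity>"
  shows "prob {\<omega> \<in> space N. emeasure (\<eta> \<omega>) B = of_nat k} =
    measure inverse_intensity B ^ k / fact k * exp (- measure inverse_intensity B)"
  using pois assms unfolding poisson_process_def by blast

lemma measurable_emeasure:
  assumes "B \<in> sets pos_borel"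
  shows "(\<lambda>\<omega>. emeasure (\<eta> \<omega>) B) \<in> borel_measurable N"
  using indep_emeasure[of "{0}" "\<lambda>_. B"] assms
  unfolding indep_vars_def by (auto simp: disjoint_family_on_def)

text \<open>The definition of a Poisson process makes the masses of Borel sets measurable; the general case follows
  by monotone class induction.\<close>

lemma measurable_nn_integral:
  assumes "g \<in> borel_measurable pos_borel"
  shows "(\<lambda>\<omega>. \<integral>\<^sup>+t. g t \<partial>\<eta> \<omega>) \<in> borel_measurable N"
proof -
  have eq: "borel_measurable (\<eta> \<omega>) = (borel_measurable pos_borel :: (real \<Rightarrow> ennreal) set)"
    if "\<omega> \<in> space N" for \<omega>
    by (rule measurable_cong_sets[OF sets_eta[OF that] refl])
  show ?thesis
    using assms
  proof (induction rule: borel_measurable_induct)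
    case (cong f g)
    have "(\<integral>\<^sup>+t. f t \<partial>\<eta> \<omega>) = (\<integral>\<^sup>+t. g t \<partial>\<eta> \<omega>)" if "\<omega> \<in> space N" for \<omega>
      using cong(3) space_eta[OF that] by (intro nn_integral_cong) (auto simp: pos_borel_def space_restrict_space)
    then show ?case using cong(4) by (simp cong: measurable_cong)
  next
    case (set A)
    have "(\<integral>\<^sup>+t. indicator A t \<partial>\<eta> \<omega>) = emeasure (\<eta> \<omega>) A" if "\<omega> \<in> space N" for \<omega>
      using set sets_eta[OF that] by simp
    then show ?case using measurable_emeasure[OF set] by (simp cong: measurable_cong)
  next
    case (mult u c)
    have "(\<integral>\<^sup>+t. c * u t \<partial>\<eta> \<omega>) = c * (\<integral>\<^sup>+t. u t \<partial>\<eta> \<omega>)" if "\<omega> \<in> space N" for \<omega>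
      using mult(2) eq[OF that] by (intro nn_integral_cmult) simp
    then show ?case using mult(4) by (simp cong: measurable_cong)
  next
    case (add u v)
    have "(\<integral>\<^sup>+t. v t + u t \<partial>\<eta> \<omega>) = (\<integral>\<^sup>+t. v t \<partial>\<eta> \<omega>) + (\<integral>\<^sup>+t. u t \<partial>\<eta> \<omega>)" if "\<omega> \<in> space N" for \<omega>
      using add eq[OF that] by (intro nn_integral_add) simp_all
    then show ?case using add by (simp cong: measurable_cong)
  next
    case (seq U)
    have "(\<integral>\<^sup>+t. (SUP i. U i) t \<partial>\<eta> \<omega>) = (SUP i. \<integral>\<^sup>+t. U i t \<partial>\<eta> \<omega>)" if "\<omega> \<in> space N" for \<omega>
      unfolding SUP_apply using seq eq[OF that] by (intro nn_integral_monotone_convergence_SUP) auto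
    then show ?case using seq by (simp cong: measurable_cong)
  qed
qed

lemma emeasure_points_in:
  assumes w: "\<omega> \<in> space N" and ab: "0 < a"
  shows "emeasure (\<eta> \<omega>) {a<..b} = of_nat (points_in \<eta> {a<..b} \<omega>)"
proof -
  have B: "{a<..b} \<in> sets (\<eta> \<omega>)" "{a..b} \<in> sets (\<eta> \<omega>)"
    using ab unfolding sets_eta[OF w] by (auto simp: pos_borel_def sets_restrict_space_iff)
  have "emeasure (\<eta> \<omega>) {a<..b} \<le> emeasure (\<eta> \<omega>) {a..b}" using B by (intro emeasure_mono) auto
  also have "\<dots> < \<infinity>" using finite_eta[OF w ab] .
  finally have "emeasure (\<eta> \<omega>) {a<..b} \<noteq> \<infinity>" by simp
  moreover have "counting_valued (\<eta> \<omega>)"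
    using pois w unfolding poisson_process_def point_process_def by simp
  ultimately obtain k :: nat where "emeasure (\<eta> \<omega>) {a<..b} = of_nat k"
    using B unfolding counting_valued_def by blast
  then show ?thesis by (simp add: points_in_def measure_def)
qed

lemma measurable_points_in:
  "B \<in> sets pos_borel \<Longrightarrow> points_in \<eta> B \<in> N \<rightarrow>\<^sub>M count_space UNIV"
  unfolding points_in_def[abs_def] measure_def using measurable_emeasure by measurable

lemma indep_points_in:
  assumes "finite I" "\<And>i. i \<in> I \<Longrightarrow> B i \<in> sets pos_borel" "disjoint_family_on B I"
  shows "indep_vars (\<lambda>_. count_space UNIV) (\<lambda>i. points_in \<eta> (B i)) (I :: nat set)"
proof -
  have "indep_vars (\<lambda>_. count_space UNIV) (\<lambda>i \<omega>. nat \<lfloor>enn2real (emeasure (\<eta> \<omega>) (B i))\<rfloor>) I"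
    by (rule indep_vars_compose2[OF indep_emeasure[OF assms]]) measurable
  then show ?thesis by (simp add: points_in_def[abs_def] measure_def)
qed

lemma prob_points_in:
  assumes ab: "0 < a" "a \<le> b"
  shows "prob {\<omega>\<in>space N. points_in \<eta> {a<..b} \<omega> = m} = ln (b / a) ^ m / fact m * exp (- ln (b / a))"
proof -
  have "prob {\<omega>\<in>space N. emeasure (\<eta> \<omega>) {a<..b} = of_nat m} = ln (b / a) ^ m / fact m * exp (- ln (b / a))"
    using prob_emeasure[of "{a<..b}" m] Ioc_in_pos_borel[of a b] ab
    by (simp add: emeasure_inverse_intensity measure_inverse_intensity)
  also have "{\<omega>\<in>space N. emeasure (\<eta> \<omega>) {a<..b} = of_nat m} = {\<omega>\<in>space N. points_in \<eta> {a<..b} \<omega> = m}"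
    using emeasure_points_in[OF _ ab(1), of _ b] by auto
  finally show ?thesis .
qed

text \<open>Campbell's formula for an interval, that is, the mean of a Poisson variable.\<close>

lemma mean_emeasure:
  assumes ab: "0 < a" "a \<le> b"
  shows "(\<integral>\<^sup>+\<omega>. emeasure (\<eta> \<omega>) {a<..b} \<partial>N) = ennreal (ln (b / a))"
proof -
  let ?Y = "points_in \<eta> {a<..b}"
  have [measurable]: "?Y \<in> N \<rightarrow>\<^sub>M count_space UNIV"
    using ab by (intro measurable_points_in Ioc_in_pos_borel) auto
  have "(\<integral>\<^sup>+\<omega>. emeasure (\<eta> \<omega>) {a<..b} \<partial>N) =
      (\<integral>\<^sup>+\<omega>. (\<Sum>m. of_nat m * indicator {\<omega>\<in>space N. ?Y \<omega> = m} \<omega>) \<partial>N)"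
  proof (rule nn_integral_cong)
    fix \<omega> assume w: "\<omega> \<in> space N"
    have "(\<Sum>m. of_nat m * indicator {\<omega>\<in>space N. ?Y \<omega> = m} \<omega>) =
        (\<Sum>m\<in>{?Y \<omega>}. of_nat m * indicator {\<omega>\<in>space N. ?Y \<omega> = m} \<omega> :: ennreal)"
      by (rule suminf_finite) auto
    then show "emeasure (\<eta> \<omega>) {a<..b} = (\<Sum>m. of_nat m * indicator {\<omega>\<in>space N. ?Y \<omega> = m} \<omega>)"
      using w emeasure_points_in[OF w ab(1)] by simp
  qed
  also have "\<dots> = (\<Sum>m. \<integral>\<^sup>+\<omega>. of_nat m * indicator {\<omega>\<in>space N. ?Y \<omega> = m} \<omega> \<partial>N)"
    by (rule nn_integral_suminf) measurable
  also have "\<dots> = (\<Sum>m. ennreal (real m * (ln (b / a) ^ m / fact m * exp (- ln (b / a)))))"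
  proof (intro arg_cong[where f = suminf] ext)
    fix m
    have "(\<integral>\<^sup>+\<omega>. of_nat m * indicator {\<omega>\<in>space N. ?Y \<omega> = m} \<omega> \<partial>N) = of_nat m * emeasure N {\<omega>\<in>space N. ?Y \<omega> = m}"
      by (rule nn_integral_cmult_indicator) measurable
    also have "\<dots> = ennreal (real m) * ennreal (ln (b / a) ^ m / fact m * exp (- ln (b / a)))"
      by (simp only: emeasure_eq_measure prob_points_in[OF ab] ennreal_of_nat_eq_real_of_nat)
    finally show "(\<integral>\<^sup>+\<omega>. of_nat m * indicator {\<omega>\<in>space N. ?Y \<omega> = m} \<omega> \<partial>N) =
        ennreal (real m * (ln (b / a) ^ m / fact m * exp (- ln (b / a))))"
      by (simp only: ennreal_mult' of_nat_0_le_iff)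
  qed
  also have "\<dots> = ennreal (ln (b / a))"
    using ab by (intro suminf_ennreal_eq poisson_mean_sums) auto
  finally show ?thesis .
qed

text \<open>The dyadic interval \<open>(2\<^sup>-\<^sup>j\<^sup>-\<^sup>1, 2\<^sup>-\<^sup>j]\<close> carries \<open>ln 2\<close> points on average, and each contributes at most
  \<open>2\<^sup>-\<^sup>j\<close>. So the sum of the points below \<open>1\<close> has finite expectation.\<close>

lemma AE_integrable_near_0: "AE \<omega> in N. integrable (\<eta> \<omega>) (\<lambda>t. indicator {..1} t * t)"
proof -
  let ?I = "\<lambda>j. {(1/2) ^ Suc j<..(1/2) ^ j :: real}"
  let ?S = "\<lambda>\<omega>. \<Sum>j. ennreal ((1/2) ^ j) * emeasure (\<eta> \<omega>) (?I j)"
  have I: "?I j \<in> sets pos_borel" for j by (intro Ioc_in_pos_borel) auto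
  have mS: "?S \<in> borel_measurable N" using measurable_emeasure[OF I] by measurable
  have le: "ennreal (indicator {..1} t * t) \<le> (\<Sum>j. ennreal ((1/2) ^ j) * indicator (?I j) t)" if "t > 0" for t :: real
  proof (cases "t \<le> 1")
    case True
    obtain m where m: "(1/2) ^ m < t" using real_arch_pow_inv[OF \<open>t > 0\<close>, of "1/2"] by auto
    define j where "j = (LEAST j. (1/2) ^ Suc j < t)"
    have "\<exists>j. (1/2) ^ Suc j < t" 
    proof
      have "(1/2 :: real) ^ Suc m \<le> (1/2) ^ m" by (rule power_decreasing) auto
      then show "(1/2) ^ Suc m < t" using m by linarith
    qed
    then have j1: "(1/2) ^ Suc j < t" unfolding j_def by (rule LeastI_ex)
    have j2: "t \<le> (1/2) ^ j"
    proof (cases j)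
      case (Suc i)
      then show ?thesis using not_less_Least[of i "\<lambda>j. (1/2) ^ Suc j < t"] j_def by (simp add: not_less)
    qed (use True in simp)
    have "ennreal (indicator {..1} t * t) \<le> (\<Sum>i\<in>{j}. ennreal ((1/2) ^ i) * indicator (?I i) t)"
      using True j1 j2 by (simp add: ennreal_leI)
    also have "\<dots> \<le> (\<Sum>j. ennreal ((1/2) ^ j) * indicator (?I j) t)"
      by (intro sum_le_suminf summableI) auto
    finally show ?thesis .
  qed simp
  have bound: "(\<integral>\<^sup>+t. ennreal (indicator {..1} t * t) \<partial>\<eta> \<omega>) \<le> ?S \<omega>" if w: "\<omega> \<in> space N" for \<omega>
  proof -
    have "(\<integral>\<^sup>+t. ennreal (indicator {..1} t * t) \<partial>\<eta> \<omega>) \<le> (\<integral>\<^sup>+t. (\<Sum>j. ennreal ((1/2) ^ j) * indicator (?I j) t) \<partial>\<eta> \<omega>)"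
      using le space_eta[OF w] by (intro nn_integral_mono) auto
    also have "\<dots> = (\<Sum>j. \<integral>\<^sup>+t. ennreal ((1/2) ^ j) * indicator (?I j) t \<partial>\<eta> \<omega>)"
      using I sets_eta[OF w] by (intro nn_integral_suminf) simp
    also have "\<dots> = ?S \<omega>"
      using I sets_eta[OF w] by (intro arg_cong[where f = suminf] ext nn_integral_cmult_indicator) simp
    finally show ?thesis .
  qed
  have "(\<integral>\<^sup>+\<omega>. ?S \<omega> \<partial>N) = (\<Sum>j. \<integral>\<^sup>+\<omega>. ennreal ((1/2) ^ j) * emeasure (\<eta> \<omega>) (?I j) \<partial>N)"
    by (intro nn_integral_suminf borel_measurable_times_ennreal borel_measurable_const measurable_emeasure I)
  also have "\<dots> = (\<Sum>j. ennreal ((1/2) ^ j * ln 2))"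
  proof (intro arg_cong[where f = suminf] ext)
    fix j
    have "(\<integral>\<^sup>+\<omega>. ennreal ((1/2) ^ j) * emeasure (\<eta> \<omega>) (?I j) \<partial>N) = ennreal ((1/2) ^ j) * ennreal (ln ((1/2) ^ j / (1/2) ^ Suc j))"
      using measurable_emeasure[OF I]
      by (subst nn_integral_cmult) (auto simp: mean_emeasure power_decreasing)
    also have "(1/2) ^ j / (1/2) ^ Suc j = (2::real)" by simp
    finally show "(\<integral>\<^sup>+\<omega>. ennreal ((1/2) ^ j) * emeasure (\<eta> \<omega>) (?I j) \<partial>N) = ennreal ((1/2) ^ j * ln 2)"
      by (simp add: ennreal_mult)
  qed
  also have "\<dots> = ennreal (1 / (1 - 1/2) * ln 2)"
    by (intro suminf_ennreal_eq sums_mult2 geometric_sums) auto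
  finally have "(\<integral>\<^sup>+\<omega>. ?S \<omega> \<partial>N) \<noteq> \<infinity>" by simp
  from nn_integral_PInf_AE[OF mS this] AE_space show ?thesis
  proof eventually_elim
    case (elim \<omega>)
    have "(\<lambda>t::real. indicator {..1} t * t) \<in> borel_measurable borel" by measurable
    then have "(\<lambda>t. indicator {..1} t * t) \<in> borel_measurable (\<eta> \<omega>)"
      unfolding measurable_cong_sets[OF sets_eta[OF elim(2)] refl] pos_borel_def
      by (rule measurable_restrict_space1)
    then show ?case
    proof (rule integrableI_nonneg)
      show "AE t in \<eta> \<omega>. 0 \<le> indicator {..1} t * t"
        using space_eta[OF elim(2)] by (intro AE_I2) (auto simp: indicator_def)
      show "(\<integral>\<^sup>+t. ennreal (indicator {..1} t * t) \<partial>\<eta> \<omega>) < \<infinity>"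
        using bound[OF elim(2)] elim(1) by (simp add: less_top top.not_eq_extremum order.strict_trans1)
    qed
  qed
qed

lemma AE_no_point_at:
  assumes "a > 0"
  shows "AE \<omega> in N. AE t in \<eta> \<omega>. t \<noteq> a"
proof -
  have B: "{a} \<in> sets pos_borel" using assms by (auto simp: pos_borel_def sets_restrict_space_iff)
  have "emeasure inverse_intensity {a} = (\<integral>\<^sup>+t. ennreal (1 / t) * indicator {a} t \<partial>restrict_space lborel {0<..})"
    unfolding inverse_intensity_def
    using B assms by (intro emeasure_density measurable_restrict_space1) (auto simp: sets_restrict_space_iff)
  also have "\<dots> = (\<integral>\<^sup>+t. ennreal (1 / t) * indicator {a} t * indicator {0<..} t \<partial>lborel)"
    by (rule nn_integral_restrict_space) auto
  also have "\<dots> = (\<integral>\<^sup>+t. 0 \<partial>(lborel :: real measure))"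
  proof (rule nn_integral_cong_AE)
    show "AE t in lborel. ennreal (1 / t) * indicator {a} t * indicator {0<..} t = 0"
      using AE_lborel_singleton[of a] by eventually_elim simp
  qed
  finally have z: "emeasure inverse_intensity {a} = 0" by simp
  have "prob {\<omega> \<in> space N. emeasure (\<eta> \<omega>) {a} = of_nat 0} = 1"
  proof -
    have "prob {\<omega> \<in> space N. emeasure (\<eta> \<omega>) {a} = of_nat 0} =
        measure inverse_intensity {a} ^ 0 / fact 0 * exp (- measure inverse_intensity {a})"
      by (rule prob_emeasure[OF B]) (simp add: z)
    then show ?thesis using z by (simp add: measure_def)
  qed
  then have "AE \<omega> in N. emeasure (\<eta> \<omega>) {a} = 0"
    using measurable_emeasure[OF B] by (subst (asm) prob_Collect_eq_1) auto
  then show ?thesis using AE_space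
  proof eventually_elim
    case (elim \<omega>)
    show ?case
      by (rule AE_I[of _ _ "{a}"]) (use elim B sets_eta in auto)
  qed
qed

end

section \<open>Convergence of the prime process and of the prime sums\<close>

context inverse_poisson
begin

lemma prob_points_in_cell:
  "prob {\<omega>\<in>space N. points_in \<eta> (cell n k) \<omega> = m} =
    (- ln (1 - 1 / real (nth_prime k))) ^ m / fact m * (1 - 1 / real (nth_prime k))"
proof -
  let ?a = "euler_product k / euler_product (Suc n)" and ?b = "euler_product (Suc k) / euler_product (Suc n)"
  have q: "0 < 1 - 1 / real (nth_prime k)" using nth_prime_ge_2[of k] by simp
  have ab: "0 < ?a" "?a \<le> ?b"
    using euler_product_pos strict_mono_less_eq[OF strict_mono_euler_product, of k "Suc k"]
    by (auto intro!: divide_right_mono simp: less_imp_le)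
  have "?b / ?a = 1 / (1 - 1 / real (nth_prime k))"
    using euler_product_pos[of k] euler_product_pos[of "Suc n"] by (simp add: euler_product_Suc[of k])
  then have "ln (?b / ?a) = - ln (1 - 1 / real (nth_prime k))" using q by (simp add: ln_div)
  then show ?thesis
    using prob_points_in[OF ab, of m] q by (simp add: cell_def)
qed

lemma weighted_points_in_cells_tendsto:
  assumes \<omega>: "\<omega> \<in> space N" and int: "integrable (\<eta> \<omega>) (\<lambda>t. indicator {..1} t * t)"
    and meas: "\<phi> \<in> borel_measurable pos_borel"
    and le: "\<And>t. 0 < t \<Longrightarrow> \<bar>\<phi> t\<bar> \<le> A * t" and vanish: "\<And>t. b < t \<Longrightarrow> \<phi> t = 0"
    and cont: "AE t in \<eta> \<omega>. isCont \<phi> t"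
  shows "(\<lambda>n. \<Sum>k | prime_point n k \<le> b.
      real (if k < K then w k else points_in \<eta> (cell n k) \<omega>) * \<phi> (prime_point n k))
    \<longlonglongrightarrow> (LINT t|\<eta> \<omega>. \<phi> t)"
proof (rule weighted_sum_prime_points_tendsto[OF space_eta[OF \<omega>] sets_eta[OF \<omega>] finite_eta[OF \<omega>] int _ _ le vanish cont])
  show "emeasure (\<eta> \<omega>) (cell n k) = of_nat (points_in \<eta> (cell n k) \<omega>)" for n k
    unfolding cell_def using euler_product_pos by (intro emeasure_points_in[OF \<omega>]) simp
  show "\<phi> \<in> borel_measurable (\<eta> \<omega>)"
    using meas measurable_cong_sets[OF sets_eta[OF \<omega>] refl] by blast
qed

text \<open>The coupling applied to the cell counts. The probability that a Poisson variable with
  \<open>P(Y = 0) = 1 - q\<close> exceeds \<open>1\<close> is \<open>q + (1 - q) ln (1 - q)\<close>, which is at most \<open>q\<^sup>2\<close>.\<close>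

lemma expectation_prime_weights_tendsto:
  fixes M :: "'a measure" and X :: "nat \<Rightarrow> 'a \<Rightarrow> nat" and G :: "nat \<Rightarrow> (nat \<Rightarrow> nat) \<Rightarrow> real"
  assumes M: "prob_space M"
    and indep: "prob_space.indep_vars M (\<lambda>_. count_space UNIV) X UNIV"
    and law: "\<And>k m. measure M {\<omega> \<in> space M. X k \<omega> = m} =
           (1 / real (nth_prime k)) ^ m * (1 - 1 / real (nth_prime k))"
    and G: "\<And>n. G n \<in> borel_measurable nat_seqs" "\<And>n w. \<bar>G n w\<bar> \<le> B"
    and \<zeta>: "\<zeta> \<in> borel_measurable N"
    and lim: "\<And>K x. AE \<omega> in N. (\<lambda>n. G n (\<lambda>k. if k < K then x k else points_in \<eta> (cell n k) \<omega>)) \<longlonglongrightarrow> \<zeta> \<omega>"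
  shows "(\<lambda>n. LINT \<omega>|M. G n (\<lambda>k. X k \<omega>)) \<longlonglongrightarrow> expectation \<zeta>"
proof (rule coupling_limit[where Y = "\<lambda>n k. points_in \<eta> (cell n k)" and s = "\<lambda>k. (1 / real (nth_prime k))\<^sup>2",
      OF M prob_space_axioms _ _ _ _ _ _ _ _ G \<zeta> lim])
  interpret M: prob_space M by fact
  show mX: "X k \<in> M \<rightarrow>\<^sub>M count_space UNIV" for k
    using indep unfolding M.indep_vars_def by auto
  show mY: "points_in \<eta> (cell n k) \<in> N \<rightarrow>\<^sub>M count_space UNIV" for n k
    by (intro measurable_points_in cell_in_pos_borel)
  show "M.indep_vars (\<lambda>_. count_space UNIV) X J" for J
    by (rule M.indep_vars_subset[OF indep]) simp
  show "indep_vars (\<lambda>_. count_space UNIV) (\<lambda>k. points_in \<eta> (cell n k)) J" if "finite J" for n and J :: "nat set"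
    by (intro indep_points_in that cell_in_pos_borel disjoint_family_on_mono[OF _ disjoint_family_cell]) simp
  show "M.prob {\<omega> \<in> space M. X k \<omega> = 0} = prob {\<omega> \<in> space N. points_in \<eta> (cell n k) \<omega> = 0}" for n k
    by (simp add: law prob_points_in_cell)
  show "M.prob {\<omega> \<in> space M. 2 \<le> X k \<omega>} \<le> (1 / real (nth_prime k))\<^sup>2" for k
    unfolding M.prob_ge_two[OF mX] law by (simp add: algebra_simps power2_eq_square)
  show "prob {\<omega> \<in> space N. 2 \<le> points_in \<eta> (cell n k) \<omega>} \<le> (1 / real (nth_prime k))\<^sup>2" for n k
  proof -
    define q where "q = 1 / real (nth_prime k)"
    have q: "0 < q" "q < 1" using nth_prime_ge_2[of k] by (auto simp: q_def)
    have "q \<le> - ln (1 - q)" using ln_le_minus_one[of "1 - q"] q by simp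
    then have "q * (1 - q) \<le> - ln (1 - q) * (1 - q)" using q by (intro mult_right_mono) auto
    then show ?thesis
      unfolding prob_ge_two[OF mY] prob_points_in_cell q_def[symmetric]
      by (simp add: algebra_simps power2_eq_square)
  qed
  show "summable (\<lambda>k. (1 / real (nth_prime k))\<^sup>2)"
  proof (rule summable_comparison_test')
    show "summable (\<lambda>k. inverse (real (Suc k)) ^ 2)"
      using inverse_power_summable[of 2, where 'a=real]
      by (subst summable_Suc_iff) (simp add: power_inverse)
    show "norm ((1 / real (nth_prime k))\<^sup>2) \<le> inverse (real (Suc k)) ^ 2" for k
    proof -
      have "1 / real (nth_prime k) \<le> inverse (real (Suc k))"
        using nth_prime_ge[of k] by (simp add: field_simps)
      then show ?thesis by (simp add: power_mono)
    qed
  qed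
qed

text \<open>The pathwise limits of the integrals of all test functions hold on one event of full probability, so
  the mixed processes converge in the vague topology there; a continuous functional preserves this.\<close>

lemma prime_process_converges:
  fixes M :: "'a measure" and X :: "nat \<Rightarrow> 'a \<Rightarrow> nat"
  assumes M: "prob_space M"
    and indep: "prob_space.indep_vars M (\<lambda>_. count_space UNIV) X UNIV"
    and law: "\<And>k m. measure M {\<omega> \<in> space M. X k \<omega> = m} =
           (1 / real (nth_prime k)) ^ m * (1 - 1 / real (nth_prime k))"
  shows "vague_convergence_in_distribution (\<lambda>_. M) (prime_process X) N \<eta>"
  unfolding vague_convergence_in_distribution_def converges_in_distribution_def
proof (intro conjI allI impI)
  interpret M: prob_space M by fact
  have mX: "X k \<in> M \<rightarrow>\<^sub>M count_space UNIV" for k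
    using indep unfolding M.indep_vars_def by auto
  show pp: "point_process M (prime_process X n)" for n
    by (rule point_process_prime_process[OF M mX])
  then show "prime_process X n \<in> M \<rightarrow>\<^sub>M topology_borel vague_topology" for n
    unfolding point_process_def by blast
  show "point_process N \<eta>" using pois unfolding poisson_process_def by blast
  then show m\<eta>: "\<eta> \<in> N \<rightarrow>\<^sub>M topology_borel vague_topology" unfolding point_process_def by blast
  fix F :: "real measure \<Rightarrow> real"
  assume F: "continuous_map vague_topology euclideanreal F \<and> bounded (F ` topspace vague_topology)"
  then obtain B where B: "\<And>\<mu>. \<mu> \<in> locally_finite_measures \<Longrightarrow> \<bar>F \<mu>\<bar> \<le> B"
    unfolding bounded_iff real_norm_def topspace_vague_topology by blast
  have mF: "F \<in> borel_measurable (topology_borel vague_topology)"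
    using F by (intro continuous_map_measurable_topology_borel) simp
  let ?G = "\<lambda>n w. F (dirac_series w (prime_point n))"
  have "(\<lambda>n. LINT \<omega>|M. ?G n (\<lambda>k. X k \<omega>)) \<longlonglongrightarrow> expectation (\<lambda>\<omega>. F (\<eta> \<omega>))"
  proof (rule expectation_prime_weights_tendsto[OF M indep law])
    show "?G n \<in> borel_measurable nat_seqs" for n
      by (rule measurable_compose[OF measurable_dirac_series_prime_point mF])
    show "\<bar>?G n w\<bar> \<le> B" for n w by (intro B dirac_series_prime_point_locally_finite)
    show "(\<lambda>\<omega>. F (\<eta> \<omega>)) \<in> borel_measurable N" by (rule measurable_compose[OF m\<eta> mF])
    fix K and x :: "nat \<Rightarrow> nat"
    show "AE \<omega> in N. (\<lambda>n. ?G n (\<lambda>k. if k < K then x k else points_in \<eta> (cell n k) \<omega>)) \<longlonglongrightarrow> F (\<eta> \<omega>)"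
      using AE_integrable_near_0 AE_space
    proof eventually_elim
      case (elim \<omega>)
      note \<omega> = elim(2)
      let ?\<mu> = "\<lambda>n. dirac_series (\<lambda>k. if k < K then x k else points_in \<eta> (cell n k) \<omega>) (prime_point n)"
      have "limitin vague_topology ?\<mu> (\<eta> \<omega>) sequentially"
      proof (rule limitin_vague_topology[OF eta_locally_finite[OF \<omega>] dirac_series_prime_point_locally_finite])
        fix f assume f: "vague_test_function f"
        obtain A b where Ab: "0 < b" "\<And>t. b < t \<Longrightarrow> f t = 0" "\<And>t. 0 < t \<Longrightarrow> \<bar>f t\<bar> \<le> A * t"
          "\<And>t. 0 < t \<Longrightarrow> isCont f t" "f \<in> borel_measurable pos_borel"
          using vague_test_functionE[OF f] by metis
        have eq: "(LINT t|dirac_series w (prime_point n). f t) =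
            (\<Sum>k | prime_point n k \<le> b. real (w k) * f (prime_point n k))" for w n
          by (rule integral_dirac_series_prime_point[OF f Ab(2)])
        show "(\<lambda>n. LINT t|?\<mu> n. f t) \<longlonglongrightarrow> (LINT t|\<eta> \<omega>. f t)"
          unfolding eq
        proof (rule weighted_points_in_cells_tendsto[OF \<omega> elim(1) Ab(5,3,2)])
          show "AE t in \<eta> \<omega>. isCont f t" using Ab(4) space_eta[OF \<omega>] by (intro AE_I2) auto
        qed
      qed
      then have "limitin euclideanreal (F \<circ> ?\<mu>) (F (\<eta> \<omega>)) sequentially"
        using F by (intro continuous_map_limit) auto
      then show ?case by (simp add: o_def)
    qed
  qed
  then show "(\<lambda>n. LINT \<omega>|M. F (prime_process X n \<omega>)) \<longlonglongrightarrow> expectation (\<lambda>\<omega>. F (\<eta> \<omega>))"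
    unfolding prime_process_eq .
qed

lemma measurable_dickman_integral:
  "(\<lambda>\<omega>. LINT t:{0<..<1}|\<eta> \<omega>. t) \<in> borel_measurable N"
proof -
  let ?g = "\<lambda>t::real. indicator {0<..<1} t *\<^sub>R t"
  have g: "?g \<in> borel_measurable pos_borel"
    unfolding pos_borel_def by (rule measurable_restrict_space1) measurable
  have "(LINT t:{0<..<1}|\<eta> \<omega>. t) = enn2real (\<integral>\<^sup>+t. ennreal (?g t) \<partial>\<eta> \<omega>)" if "\<omega> \<in> space N" for \<omega>
    unfolding set_lebesgue_integral_def
  proof (rule integral_eq_nn_integral)
    show "?g \<in> borel_measurable (\<eta> \<omega>)"
      using g measurable_cong_sets[OF sets_eta[OF that] refl] by blast
  qed (auto simp: indicator_def)
  moreover have "(\<lambda>\<omega>. enn2real (\<integral>\<^sup>+t. ennreal (?g t) \<partial>\<eta> \<omega>)) \<in> borel_measurable N"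
    by (intro borel_measurable_enn2real measurable_nn_integral measurable_compose[OF g measurable_ennreal])
  ultimately show ?thesis by (simp cong: measurable_cong)
qed

text \<open>The sum up to \<open>n\<close> is the integral over the prime process of the identity cut off at \<open>1\<close>. The cut-off
  function is discontinuous only at \<open>1\<close>, where \<open>\<eta>\<close> almost surely has no point.\<close>

lemma prime_sums_converge:
  fixes M :: "'a measure" and X :: "nat \<Rightarrow> 'a \<Rightarrow> nat"
  assumes M: "prob_space M"
    and indep: "prob_space.indep_vars M (\<lambda>_. count_space UNIV) X UNIV"
    and law: "\<And>k m. measure M {\<omega> \<in> space M. X k \<omega> = m} =
           (1 / real (nth_prime k)) ^ m * (1 - 1 / real (nth_prime k))"
  shows "weak_conv_m
      (\<lambda>n. distr M borel (\<lambda>\<omega>. (1 / ln (real (nth_prime n))) *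
                                (\<Sum>k\<le>n. real (X k \<omega>) * ln (real (nth_prime k)))))
      (dickman_law N \<eta>)"
proof -
  interpret M: prob_space M by fact
  define S where "S n w = (\<Sum>k\<le>n. real (w k) * prime_point n k)" for n and w :: "nat \<Rightarrow> nat"
  define I where "I \<omega> = (LINT t:{0<..<1}|\<eta> \<omega>. t)" for \<omega>
  define \<phi> where "\<phi> t = (if t \<le> 1 then t else 0)" for t :: real
  have mX[measurable]: "X k \<in> M \<rightarrow>\<^sub>M count_space UNIV" for k
    using indep unfolding M.indep_vars_def by auto
  have mI: "I \<in> borel_measurable N" unfolding I_def by (rule measurable_dickman_integral)
  have mS: "S n \<in> borel_measurable nat_seqs" for n
    unfolding S_def by measurable
  have S_eq: "(1 / ln (real (nth_prime n))) * (\<Sum>k\<le>n. real (X k \<omega>) * ln (real (nth_prime k))) = S n (\<lambda>k. X k \<omega>)" for n \<omega>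
    by (simp add: S_def prime_point_def sum_distrib_left)
  have mSX: "(\<lambda>\<omega>. S n (\<lambda>k. X k \<omega>)) \<in> borel_measurable M" for n
    unfolding S_def by measurable
  have cont: "isCont \<phi> t" if "t \<noteq> 1" for t
  proof (cases "t < 1")
    case True
    have "eventually (\<lambda>s. \<phi> s = s) (nhds t)"
      using eventually_nhds_in_open[of "{..<1}" t] True by (auto elim!: eventually_mono simp: \<phi>_def)
    then show ?thesis using isCont_cong[of \<phi> "\<lambda>s. s" t] by simp
  next
    case False
    then have "eventually (\<lambda>s. \<phi> s = 0) (nhds t)"
      using eventually_nhds_in_open[of "{1<..}" t] that by (auto elim!: eventually_mono simp: \<phi>_def)
    then show ?thesis using isCont_cong[of \<phi> "\<lambda>s. 0" t] by simp
  qed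
  have m\<phi>: "\<phi> \<in> borel_measurable pos_borel"
    unfolding pos_borel_def \<phi>_def[abs_def] by (rule measurable_restrict_space1) measurable
  have lim: "AE \<omega> in N. (\<lambda>n. S n (\<lambda>k. if k < K then x k else points_in \<eta> (cell n k) \<omega>)) \<longlonglongrightarrow> I \<omega>" for K x
  proof -
    have sum: "S n w = (\<Sum>k | prime_point n k \<le> 1. real (w k) * \<phi> (prime_point n k))" for n w
      unfolding S_def prime_point_le_1_iff
      by (intro sum.cong) (auto simp: \<phi>_def prime_point_le_1_iff)
    show ?thesis
      using AE_no_point_at[of 1, OF zero_less_one] AE_integrable_near_0 AE_space
    proof eventually_elim
      case (elim \<omega>)
      have "(\<lambda>n. \<Sum>k | prime_point n k \<le> 1.
          real (if k < K then x k else points_in \<eta> (cell n k) \<omega>) * \<phi> (prime_point n k)) \<longlonglongrightarrow> (LINT t|\<eta> \<omega>. \<phi> t)"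
      proof (rule weighted_points_in_cells_tendsto[OF elim(3,2) m\<phi>])
        show "\<bar>\<phi> t\<bar> \<le> 1 * t" if "0 < t" for t using that by (simp add: \<phi>_def)
        show "\<phi> t = 0" if "1 < t" for t using that by (simp add: \<phi>_def)
        show "AE t in \<eta> \<omega>. isCont \<phi> t" using elim(1) by eventually_elim (rule cont)
      qed
      moreover have "(LINT t|\<eta> \<omega>. \<phi> t) = I \<omega>"
        unfolding I_def set_lebesgue_integral_def
      proof (rule integral_cong_AE)
        show "\<phi> \<in> borel_measurable (\<eta> \<omega>)"
          using m\<phi> measurable_cong_sets[OF sets_eta[OF elim(3)] refl] by blast
        have "(\<lambda>t::real. indicator {0<..<1} t *\<^sub>R t) \<in> borel_measurable pos_borel"
          unfolding pos_borel_def by (rule measurable_restrict_space1) measurable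
        then show "(\<lambda>t. indicator {0<..<1} t *\<^sub>R t) \<in> borel_measurable (\<eta> \<omega>)"
          using measurable_cong_sets[OF sets_eta[OF elim(3)] refl] by blast
        show "AE t in \<eta> \<omega>. \<phi> t = indicator {0<..<1} t *\<^sub>R t"
          using elim(1) AE_space
        proof eventually_elim
          case (elim t)
          then show ?case using space_eta[OF \<open>\<omega> \<in> space N\<close>] by (auto simp: \<phi>_def indicator_def)
        qed
      qed
      ultimately show ?case unfolding sum by simp
    qed
  qed
  have "weak_conv_m (\<lambda>n. distr M borel (\<lambda>\<omega>. S n (\<lambda>k. X k \<omega>))) (distr N borel I)"
  proof (rule integral_cts_step_conv_imp_weak_conv)
    show "real_distribution (distr M borel (\<lambda>\<omega>. S n (\<lambda>k. X k \<omega>)))" for n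
      by (rule M.real_distribution_distr[OF mSX])
    show "real_distribution (distr N borel I)" by (rule real_distribution_distr[OF mI])
    fix x y :: real assume xy: "x < y"
    let ?c = "cts_step x y"
    have cc: "continuous_on UNIV ?c"
      using cts_step_uniformly_continuous[OF xy] by (rule uniformly_continuous_imp_continuous)
    have mc: "?c \<in> borel_measurable borel" using cc by (rule borel_measurable_continuous_onI)
    have "(\<lambda>n. LINT \<omega>|M. ?c (S n (\<lambda>k. X k \<omega>))) \<longlonglongrightarrow> expectation (\<lambda>\<omega>. ?c (I \<omega>))"
    proof (rule expectation_prime_weights_tendsto[OF M indep law])
      show "(\<lambda>w. ?c (S n w)) \<in> borel_measurable nat_seqs" for n
        by (rule measurable_compose[OF mS mc])
      show "\<bar>?c (S n w)\<bar> \<le> 1" for n w using xy by (auto simp: cts_step_def)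
      show "(\<lambda>\<omega>. ?c (I \<omega>)) \<in> borel_measurable N" by (rule measurable_compose[OF mI mc])
      show "AE \<omega> in N. (\<lambda>n. ?c (S n (\<lambda>k. if k < K then w k else points_in \<eta> (cell n k) \<omega>))) \<longlonglongrightarrow> ?c (I \<omega>)" for K w
        using lim[of K w]
      proof eventually_elim
        case (elim \<omega>)
        have "isCont ?c (I \<omega>)" using cc by (simp add: continuous_on_eq_continuous_at)
        then show ?case using elim by (rule isCont_tendsto_compose)
      qed
    qed
    then show "(\<lambda>n. integral\<^sup>L (distr M borel (\<lambda>\<omega>. S n (\<lambda>k. X k \<omega>))) ?c) \<longlonglongrightarrow> integral\<^sup>L (distr N borel I) ?c"
      by (simp add: integral_distr[OF mSX mc] integral_distr[OF mI mc])
  qed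
  then show ?thesis unfolding S_eq dickman_law_def I_def[abs_def] .
qed

end

theorem theorem3p6:
  fixes M :: "'a measure" and X :: "nat \<Rightarrow> 'a \<Rightarrow> nat"
    and N :: "'b measure" and \<eta> :: "'b \<Rightarrow> real measure"
    and P :: "'c measure" and D :: "'c \<Rightarrow> real"
  assumes "prob_space M"
    and "prob_space.indep_vars M (\<lambda>_. count_space UNIV) X UNIV"
    and "\<And>k m. measure M {\<omega> \<in> space M. X k \<omega> = m} =
           (1 / real (nth_prime k)) ^ m * (1 - 1 / real (nth_prime k))"
    and "poisson_process inverse_intensity N \<eta>"
    and "prob_space P" and "D \<in> borel_measurable P" and "distr P borel D = dickman_law N \<eta>"
  shows "vague_convergence_in_distribution (\<lambda>_. M) (prime_process X) N \<eta> \<and>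
    weak_conv_m
      (\<lambda>n. distr M borel (\<lambda>\<omega>. (1 / ln (real (nth_prime n))) *
                                (\<Sum>k\<le>n. real (X k \<omega>) * ln (real (nth_prime k)))))
      (distr P borel D)"
proof -
  interpret inverse_poisson N \<eta> by standard (rule assms(4))
  show ?thesis
    using prime_process_converges[OF assms(1-3)] prime_sums_converge[OF assms(1-3)]
    unfolding assms(7) by blast
qed

end
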